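(* Let $v$ be a vertex of tenacity $t\le l_m$ and let $p$ be a $\mathrm{maxlevel}(v)$ path. Then $p$ contains exactly one bridge of tenacity $t$.
   Context: $G=(V,E)$ is a finite undirected graph with a matching $M$, with at least one unmatched vertex. Alternating paths are simple paths alternating between unmatched edges (not in $M$) and matched edges (in $M$), starting with an unmatched edge when starting at an unmatched vertex. $l_m$ is the minimum length of an augmenting path (alternating path between two distinct unmatched vertices), $\infty$ if none. $\mathrm{evenlevel}(v)$, $\mathrm{oddlevel}(v)$ are the minimum lengths of even, resp. odd, alternating paths from an unmatched vertex to $v$ ($\infty$ if none); such minimum paths are $\mathrm{evenlevel}(v)$, $\mathrm{oddlevel}(v)$ paths. $\mathrm{minlevel}(v)$ and $\mathrm{maxlevel}(v)$ are the smaller and larger of the two; a $\mathrm{minlevel}(v)$ (resp. $\mathrm{maxlevel}(v)$) path is an $\mathrm{evenlevel}(v)$ or $\mathrm{oddlevel}(v)$ path of length $\mathrm{minlevel}(v)$ (resp. $\mathrm{maxlevel}(v)$). Tenacity of a vertex: $t(v)=\mathrm{evenlevel}(v)+\mathrm{oddlevel}(v)$; of an unmatched edge $(u,v)$: $\mathrm{evenlevel}(u)+\mathrm{evenlevel}(v)+1$; of a matched edge $(u,v)$: $\mathrm{oddlevel}(u)+\mathrm{oddlevel}(v)+1$. An edge $(u,v)$ is a prop if it is the last edge of some $\mathrm{minlevel}(v)$ path (or, symmetrically, of some $\mathrm{minlevel}(u)$ path); an edge that is not a prop is a bridge. *)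

theory Defs
  imports Main "HOL-Library.Extended_Nat"
begin

definition finite_graph :: "'a set \<Rightarrow> 'a set set \<Rightarrow> bool" where
  "finite_graph V E \<longleftrightarrow> finite V \<and> (\<forall>e\<in>E. e \<subseteq> V \<and> card e = 2)"

definition matching :: "'a set set \<Rightarrow> 'a set set \<Rightarrow> bool" where
  "matching E M \<longleftrightarrow> M \<subseteq> E \<and> (\<forall>e\<in>M. \<forall>f\<in>M. e \<noteq> f \<longrightarrow> e \<inter> f = {})"

definition unmatched :: "'a set \<Rightarrow> 'a set set \<Rightarrow> 'a set" where
  "unmatched V M = V - \<Union>M"

text \<open>A path is represented by its nonempty list of vertices.\<close>

fun path_edges :: "'a list \<Rightarrow> 'a set list" where
  "path_edges (u # v # vs) = {u, v} # path_edges (v # vs)"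
| "path_edges _ = []"

definition simple_path :: "'a set \<Rightarrow> 'a set set \<Rightarrow> 'a list \<Rightarrow> bool" where
  "simple_path V E p \<longleftrightarrow>
     p \<noteq> [] \<and> distinct p \<and> set p \<subseteq> V \<and> set (path_edges p) \<subseteq> E"

text \<open>The first edge of an alternating path that starts at an unmatched vertex is
  automatically not in \<open>M\<close>, because no edge of \<open>M\<close> is incident to that vertex.\<close>

definition alternating_path :: "'a set \<Rightarrow> 'a set set \<Rightarrow> 'a set set \<Rightarrow> 'a list \<Rightarrow> bool" where
  "alternating_path V E M p \<longleftrightarrow>
     simple_path V E p \<and> successively (\<lambda>e f. e \<in> M \<longleftrightarrow> f \<notin> M) (path_edges p)"

definition path_length :: "'a list \<Rightarrow> nat" where
  "path_length p = length (path_edges p)"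

definition augmenting_path :: "'a set \<Rightarrow> 'a set set \<Rightarrow> 'a set set \<Rightarrow> 'a list \<Rightarrow> bool" where
  "augmenting_path V E M p \<longleftrightarrow>
     alternating_path V E M p \<and> hd p \<in> unmatched V M \<and> last p \<in> unmatched V M
       \<and> hd p \<noteq> last p"

text \<open>Below, the infimum of the empty set of extended naturals is \<open>\<infinity>\<close>.\<close>

definition min_augmenting_length :: "'a set \<Rightarrow> 'a set set \<Rightarrow> 'a set set \<Rightarrow> enat" where
  "min_augmenting_length V E M = (INF p\<in>{p. augmenting_path V E M p}. enat (path_length p))"

definition alternating_path_to ::
    "'a set \<Rightarrow> 'a set set \<Rightarrow> 'a set set \<Rightarrow> 'a \<Rightarrow> 'a list \<Rightarrow> bool" where
  "alternating_path_to V E M v p \<longleftrightarrow>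
     alternating_path V E M p \<and> hd p \<in> unmatched V M \<and> last p = v"

definition evenlevel :: "'a set \<Rightarrow> 'a set set \<Rightarrow> 'a set set \<Rightarrow> 'a \<Rightarrow> enat" where
  "evenlevel V E M v =
     (INF p\<in>{p. alternating_path_to V E M v p \<and> even (path_length p)}. enat (path_length p))"

definition oddlevel :: "'a set \<Rightarrow> 'a set set \<Rightarrow> 'a set set \<Rightarrow> 'a \<Rightarrow> enat" where
  "oddlevel V E M v =
     (INF p\<in>{p. alternating_path_to V E M v p \<and> odd (path_length p)}. enat (path_length p))"

definition evenlevel_path :: "'a set \<Rightarrow> 'a set set \<Rightarrow> 'a set set \<Rightarrow> 'a \<Rightarrow> 'a list \<Rightarrow> bool" where
  "evenlevel_path V E M v p \<longleftrightarrow>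
     alternating_path_to V E M v p \<and> even (path_length p)
       \<and> enat (path_length p) = evenlevel V E M v"

definition oddlevel_path :: "'a set \<Rightarrow> 'a set set \<Rightarrow> 'a set set \<Rightarrow> 'a \<Rightarrow> 'a list \<Rightarrow> bool" where
  "oddlevel_path V E M v p \<longleftrightarrow>
     alternating_path_to V E M v p \<and> odd (path_length p)
       \<and> enat (path_length p) = oddlevel V E M v"

definition minlevel :: "'a set \<Rightarrow> 'a set set \<Rightarrow> 'a set set \<Rightarrow> 'a \<Rightarrow> enat" where
  "minlevel V E M v = min (evenlevel V E M v) (oddlevel V E M v)"

definition maxlevel :: "'a set \<Rightarrow> 'a set set \<Rightarrow> 'a set set \<Rightarrow> 'a \<Rightarrow> enat" where
  "maxlevel V E M v = max (evenlevel V E M v) (oddlevel V E M v)"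

definition minlevel_path :: "'a set \<Rightarrow> 'a set set \<Rightarrow> 'a set set \<Rightarrow> 'a \<Rightarrow> 'a list \<Rightarrow> bool" where
  "minlevel_path V E M v p \<longleftrightarrow>
     (evenlevel_path V E M v p \<or> oddlevel_path V E M v p)
       \<and> enat (path_length p) = minlevel V E M v"

definition maxlevel_path :: "'a set \<Rightarrow> 'a set set \<Rightarrow> 'a set set \<Rightarrow> 'a \<Rightarrow> 'a list \<Rightarrow> bool" where
  "maxlevel_path V E M v p \<longleftrightarrow>
     (evenlevel_path V E M v p \<or> oddlevel_path V E M v p)
       \<and> enat (path_length p) = maxlevel V E M v"

definition vertex_tenacity :: "'a set \<Rightarrow> 'a set set \<Rightarrow> 'a set set \<Rightarrow> 'a \<Rightarrow> enat" where
  "vertex_tenacity V E M v = evenlevel V E M v + oddlevel V E M v"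

text \<open>The sums range over the two endpoints of the edge \<open>e\<close>.\<close>

definition edge_tenacity :: "'a set \<Rightarrow> 'a set set \<Rightarrow> 'a set set \<Rightarrow> 'a set \<Rightarrow> enat" where
  "edge_tenacity V E M e =
     (if e \<in> M then (\<Sum>u\<in>e. oddlevel V E M u) + 1 else (\<Sum>u\<in>e. evenlevel V E M u) + 1)"

definition prop_edge :: "'a set \<Rightarrow> 'a set set \<Rightarrow> 'a set set \<Rightarrow> 'a set \<Rightarrow> bool" where
  "prop_edge V E M e \<longleftrightarrow>
     e \<in> E \<and> (\<exists>v\<in>e. \<exists>p. minlevel_path V E M v p \<and> path_edges p \<noteq> [] \<and> last (path_edges p) = e)"

definition bridge :: "'a set \<Rightarrow> 'a set set \<Rightarrow> 'a set set \<Rightarrow> 'a set \<Rightarrow> bool" where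
  "bridge V E M e \<longleftrightarrow> e \<in> E \<and> \<not> prop_edge V E M e"

end

theory Submission
  imports Defs
begin

text \<open>
Let \<open>p\<close> be a shortest alternating path of its parity to \<open>v\<close>, of length \<open>k\<close>, let \<open>b\<close> be the level of \<open>v\<close>
of the other parity, and for a position \<open>n\<close> let \<open>L\<^sub>n\<close> and \<open>B\<^sub>n\<close> be the levels of \<open>p ! n\<close> of parity
\<open>n\<close> and of the opposite parity. The \<open>n\<close>-th edge has tenacity \<open>L\<^sub>n + B\<^sub>n\<^sub>+\<^sub>1 + 1\<close>. Everything rests on
one exchange argument: if another alternating path first meets the part of \<open>p\<close> from position \<open>g\<close> on
at its own position \<open>h\<close> and at position \<open>n\<close> of \<open>p\<close>, then either the parities agree and \<open>h \<ge> n\<close> (continue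
along \<open>p\<close>), or they differ and \<open>B\<^sub>g + g \<le> h + n\<close> (walk back along \<open>p\<close>).

Applied to a path realising \<open>b\<close> it gives \<open>B\<^sub>n + n \<le> k + b = t\<close> for \<open>n > b\<close>, so no edge beyond position
\<open>b\<close> exceeds tenacity \<open>t\<close>, and an edge \<open>n\<close> attains \<open>t\<close> iff \<open>L\<^sub>n = n\<close> and \<open>B\<^sub>n\<^sub>+\<^sub>1 + n + 1 = t\<close>. For two
bridges \<open>i < j\<close> of tenacity \<open>t\<close>, two more applications give \<open>t < (i + 1) + j\<close> and \<open>(i + 1) + j < t\<close>.

For existence, call the last vertex of tenacity at least \<open>s\<close> on a shortest path to \<open>u\<close> a base of
\<open>u\<close>. By induction on \<open>s \<le> l\<^sub>m\<close> the base depends only on \<open>u\<close>, and the endpoints of an edge of tenacity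
below \<open>s\<close> have the same base. Let \<open>a < t/2 < c\<close> be the consecutive positions on \<open>p\<close> carrying vertices
of tenacity at least \<open>t\<close>. These vertices are their own bases, so some edge between them has
tenacity at least \<open>t\<close>, and that edge is the bridge.
\<close>

section \<open>Edges of vertex lists, extended naturals\<close>

lemma length_path_edges: "length (path_edges p) = length p - 1"
  by (induction p rule: path_edges.induct) auto

lemma nth_path_edges: "Suc i < length p \<Longrightarrow> path_edges p ! i = {p ! i, p ! Suc i}"
proof (induction p arbitrary: i rule: path_edges.induct)
  case (1 u v vs)
  then show ?case by (cases i) auto
qed auto

lemma in_set_path_edges:
  "e \<in> set (path_edges p) \<longleftrightarrow> (\<exists>i. Suc i < length p \<and> e = {p ! i, p ! Suc i})"
  by (auto simp: in_set_conv_nth length_path_edges nth_path_edges less_diff_conv)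

lemma last_index_with:
  fixes a b :: nat
  assumes "Q a" "a \<le> b"
  obtains m where "a \<le> m" "m \<le> b" "Q m" "\<And>i. m < i \<Longrightarrow> i \<le> b \<Longrightarrow> \<not> Q i"
proof -
  define m where "m = (GREATEST i. i \<le> b \<and> Q i)"
  have "m \<le> b \<and> Q m" unfolding m_def by (rule GreatestI_nat[of _ a b]) (use assms in auto)
  moreover have le: "i \<le> m" if "i \<le> b" "Q i" for i
    unfolding m_def by (rule Greatest_le_nat[of _ _ b]) (use that in auto)
  ultimately show thesis using that[of m] assms by (meson not_le)
qed

lemma enat_Suc_le_imp: "enat (Suc s) \<le> x \<Longrightarrow> enat s \<le> x"
  by (meson Suc_n_not_le_n enat_ord_simps(1) linear order_trans)

lemma less_enat_Suc: "x < enat (Suc s) \<longleftrightarrow> x \<le> enat s"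
  by (cases x) auto

section \<open>Alternating paths and levels by position\<close>

locale matched_graph =
  fixes V :: "'a set" and E M :: "'a set set"
  assumes graph: "finite_graph V E" and matching: "matching E M"
begin

text \<open>Alternation is tied to the parity of the position: the unmatched start forces edge 0 out
  of \<open>M\<close>. Splicing paths then only requires checking parities.\<close>

definition apath :: "nat \<Rightarrow> 'a list \<Rightarrow> bool" where
  "apath k p \<longleftrightarrow> length p = Suc k \<and> distinct p \<and> set p \<subseteq> V \<and> p ! 0 \<in> unmatched V M \<and>
     (\<forall>i<k. {p ! i, p ! Suc i} \<in> E \<and> ({p ! i, p ! Suc i} \<in> M \<longleftrightarrow> odd i))"

text \<open>A Boolean parity lets \<open>even n\<close> and \<open>odd n\<close> be plugged in, so
  the two levels are handled by a single argument.\<close>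

definition level :: "bool \<Rightarrow> 'a \<Rightarrow> enat" where
  "level c v = (if c then evenlevel V E M v else oddlevel V E M v)"

definition ten :: "'a \<Rightarrow> enat" where
  "ten v = vertex_tenacity V E M v"

text \<open>Shortest among paths of its own parity only; the level of the other parity may be
  smaller.\<close>

definition minpath :: "nat \<Rightarrow> 'a list \<Rightarrow> bool" where
  "minpath k p \<longleftrightarrow> apath k p \<and> level (even k) (p ! k) = enat k"

lemma edge_neq: "{u, w} \<in> E \<Longrightarrow> u \<noteq> w"
  using graph by (auto simp: finite_graph_def)

lemma edge_in_V: "{u, w} \<in> E \<Longrightarrow> u \<in> V \<and> w \<in> V"
  using graph by (auto simp: finite_graph_def)

lemma matching_unique: "{u, w} \<in> M \<Longrightarrow> {u, x} \<in> M \<Longrightarrow> w = x"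
  using matching by (auto simp: matching_def doubleton_eq_iff) (metis doubleton_eq_iff insert_disjoint(1) insertI1)

lemma apathD:
  assumes "apath k p"
  shows "length p = Suc k" "distinct p" "set p \<subseteq> V" "p ! 0 \<in> unmatched V M"
    "\<And>i. i < k \<Longrightarrow> {p ! i, p ! Suc i} \<in> E"
    "\<And>i. i < k \<Longrightarrow> {p ! i, p ! Suc i} \<in> M \<longleftrightarrow> odd i"
  using assms by (auto simp: apath_def)

lemma apath_inj: "apath k p \<Longrightarrow> i \<le> k \<Longrightarrow> j \<le> k \<Longrightarrow> p ! i = p ! j \<Longrightarrow> i = j"
  by (auto simp: apath_def nth_eq_iff_index_eq)

lemma alternating_path_to_iff:
  "alternating_path_to V E M v p \<and> path_length p = k \<longleftrightarrow> apath k p \<and> p ! k = v"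
proof
  assume L: "alternating_path_to V E M v p \<and> path_length p = k"
  then have sp: "p \<noteq> []" "distinct p" "set p \<subseteq> V" "set (path_edges p) \<subseteq> E"
    and su: "successively (\<lambda>e f. e \<in> M \<longleftrightarrow> f \<notin> M) (path_edges p)"
    and hd: "hd p \<in> unmatched V M" and la: "last p = v" and "length p - 1 = k"
    by (auto simp: alternating_path_to_def alternating_path_def simple_path_def path_length_def
        length_path_edges)
  then have len: "length p = Suc k" by (cases p) auto
  have hd0: "p ! 0 \<in> unmatched V M" using hd sp by (simp add: hd_conv_nth)
  have e: "{p ! i, p ! Suc i} \<in> E" if "i < k" for i
    by (rule subsetD[OF sp(4)]) (use that len in \<open>auto simp: in_set_path_edges\<close>)
  \<comment> \<open>Alternation propagates along the path from edge 0, which is outside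
    \<open>M\<close> because the start is unmatched.\<close>
  have "{p ! i, p ! Suc i} \<in> M \<longleftrightarrow> odd i" if "i < k" for i
    using that
  proof (induction i)
    case 0
    show ?case using hd0 by (auto simp: unmatched_def)
  next
    case (Suc i)
    have "path_edges p ! i \<in> M \<longleftrightarrow> path_edges p ! Suc i \<notin> M"
      using su Suc.prems len by (auto simp: successively_conv_nth length_path_edges)
    then show ?case using Suc len by (auto simp: nth_path_edges)
  qed
  then show "apath k p \<and> p ! k = v"
    using len sp hd0 e la by (auto simp: apath_def last_conv_nth)
next
  assume R: "apath k p \<and> p ! k = v"
  then have a: "apath k p" by simp
  note D = apathD[OF a]
  have ne: "p \<noteq> []" using D(1) by auto
  have "successively (\<lambda>e f. e \<in> M \<longleftrightarrow> f \<notin> M) (path_edges p)"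
    using D by (auto simp: successively_conv_nth length_path_edges nth_path_edges)
  moreover have "set (path_edges p) \<subseteq> E" using D by (auto simp: in_set_path_edges)
  ultimately show "alternating_path_to V E M v p \<and> path_length p = k"
    using R D ne by (auto simp: alternating_path_to_def alternating_path_def simple_path_def
        path_length_def length_path_edges hd_conv_nth last_conv_nth)
qed

lemma level_INF: "level c v = (INF k\<in>{k. \<exists>p. apath k p \<and> p ! k = v \<and> even k = c}. enat k)"
proof -
  have "(\<lambda>p. enat (path_length p)) ` {p. alternating_path_to V E M v p \<and> even (path_length p) = c}
     = enat ` {k. \<exists>p. apath k p \<and> p ! k = v \<and> even k = c}"
    using alternating_path_to_iff by (auto simp: image_iff) metis+
  then show ?thesis by (cases c) (auto simp: level_def evenlevel_def oddlevel_def)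
qed

lemma level_le: "apath k p \<Longrightarrow> level (even k) (p ! k) \<le> enat k"
  unfolding level_INF by (rule INF_lower) auto

text \<open>A finite level means that the index set is nonempty, since the empty infimum is
  infinity; the infimum is then a least element.\<close>

lemma level_obtain:
  assumes "level c v = enat k"
  obtains p where "minpath k p" "p ! k = v" "even k = c"
proof -
  let ?A = "{k. \<exists>p. apath k p \<and> p ! k = v \<and> even k = c}"
  have inf: "Inf (enat ` ?A) = enat k" using assms by (simp add: level_INF)
  have "enat ` ?A \<noteq> {}"
  proof
    assume "enat ` ?A = {}"
    then show False using inf by (simp only: Inf_enat_def) simp
  qed
  then have "Inf (enat ` ?A) \<in> enat ` ?A" by (metis (no_types, lifting) Inf_enat_def LeastI ex_in_conv)
  then obtain p where "apath k p" "p ! k = v" "even k = c" using inf by auto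
  then show thesis using assms by (intro that[of p]) (auto simp: minpath_def)
qed

lemma level_even_odd: "level c v = enat k \<Longrightarrow> c = even k"
  using level_obtain by metis

lemma minpathD: "minpath k p \<Longrightarrow> apath k p" "minpath k p \<Longrightarrow> level (even k) (p ! k) = enat k"
  by (auto simp: minpath_def)

lemma minpath_le:
  assumes "minpath k p" "apath j q" "q ! j = p ! k" "even j = even k"
  shows "k \<le> j"
  using assms level_le[OF assms(2)] by (simp add: minpath_def)

lemma ten_eq: "ten v = level (even (n::nat)) v + level (odd n) v"
  by (auto simp: ten_def level_def vertex_tenacity_def add.commute)

lemma apath_take:
  assumes "apath k p" "n \<le> k"
  shows "apath n (take (Suc n) p)"
  using assms set_take_subset[of "Suc n" p] by (auto simp: apath_def)

lemma level_nth_le: "apath k p \<Longrightarrow> n \<le> k \<Longrightarrow> level (even n) (p ! n) \<le> enat n"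
  using level_le[OF apath_take] by simp

lemma minpath_take:
  assumes "apath k p" "n \<le> k" "level (even n) (p ! n) = enat n"
  shows "minpath n (take (Suc n) p)"
  using assms apath_take by (auto simp: minpath_def)

lemma apath_snoc:
  assumes "apath k p" "{p ! k, w} \<in> E" "{p ! k, w} \<in> M \<longleftrightarrow> odd k" "w \<notin> set p"
  shows "apath (Suc k) (p @ [w])"
  using assms edge_in_V[OF assms(2)] by (auto simp: apath_def nth_append less_Suc_eq)

section \<open>Splicing paths and the exchange argument\<close>

text \<open>Follow \<open>R\<close> to the common vertex and continue on \<open>Q\<close>. Equal
  parities keep the alternation, and only the retained pieces have to be disjoint.\<close>

lemma apath_join:
  assumes R: "apath l R" and Q: "apath k Q" and h: "h \<le> l" and n: "n \<le> k" and eq: "R ! h = Q ! n"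
    and par: "even h = even n" and dis: "\<And>i j. i < h \<Longrightarrow> n \<le> j \<Longrightarrow> j \<le> k \<Longrightarrow> R ! i \<noteq> Q ! j"
  shows "apath (h + k - n) (take h R @ drop n Q)" (is "apath ?l ?S")
proof -
  note r = apathD[OF R] and q = apathD[OF Q]
  have len: "length ?S = Suc ?l" using r q h n by auto
  have nth1: "?S ! i = R ! i" if "i \<le> h" for i
    using that r q h n eq by (cases "i = h") (auto simp: nth_append)
  have nth2: "?S ! i = Q ! (n + (i - h))" if "h \<le> i" for i
    using that r q h n by (auto simp: nth_append)
  have "set (take h R) \<inter> set (drop n Q) = {}"
  proof (rule ccontr)
    assume "set (take h R) \<inter> set (drop n Q) \<noteq> {}"
    then obtain i j where "i < h" "i < length R" "j < length Q - n" "R ! i = Q ! (n + j)"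
      using q n by (auto simp: in_set_conv_nth)
    then show False using dis[of i "n + j"] q by auto
  qed
  then have dist: "distinct ?S" using r q by auto
  have sub: "set ?S \<subseteq> V"
    using r(3) q(3) set_take_subset[of h R] set_drop_subset[of n Q] by auto
  have "{?S ! i, ?S ! Suc i} \<in> E \<and> ({?S ! i, ?S ! Suc i} \<in> M \<longleftrightarrow> odd i)" if i: "i < ?l" for i
  proof (cases "i < h")
    case True
    then show ?thesis using r(5,6)[of i] h by (simp add: nth1)
  next
    case False
    define j where "j = n + (i - h)"
    have "?S ! i = Q ! j" "?S ! Suc i = Q ! Suc j"
      using False by (auto simp: nth2 j_def Suc_diff_le)
    moreover have "j < k" using i False n by (auto simp: j_def)
    moreover have "odd i = odd j" using False par by (auto simp: j_def)
    ultimately show ?thesis using q(5,6)[of j] by auto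
  qed
  then show ?thesis using len dist sub r(4) nth1[of 0] by (auto simp: apath_def)
qed

text \<open>Follow \<open>R\<close> to the common vertex and walk back on \<open>Q\<close> to
  position \<open>g\<close>. Reversing the direction flips the parity, so here the parities at the
  common vertex must differ.\<close>

lemma apath_join_rev:
  assumes R: "apath l R" and Q: "apath k Q" and h: "h \<le> l" and n: "n \<le> k" and eq: "R ! h = Q ! n"
    and par: "even h \<noteq> even n" and g: "g \<le> n"
    and dis: "\<And>i j. i < h \<Longrightarrow> g \<le> j \<Longrightarrow> j \<le> n \<Longrightarrow> R ! i \<noteq> Q ! j"
  shows "\<exists>S. apath (h + n - g) S \<and> S ! (h + n - g) = Q ! g"
proof -
  define S where "S = take h R @ map (\<lambda>j. Q ! (n - j)) [0..<Suc (n - g)]"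
  let ?l = "h + n - g"
  note r = apathD[OF R] and q = apathD[OF Q]
  have len: "length S = Suc ?l" using r q h n g by (auto simp: S_def)
  have nth1: "S ! i = R ! i" if "i \<le> h" for i
    using that r q h n eq by (cases "i = h") (auto simp: nth_append S_def simp del: upt_Suc)
  have nth2: "S ! i = Q ! (n - (i - h))" if "h \<le> i" "i \<le> ?l" for i
    using that r q h n g by (auto simp: nth_append S_def simp del: upt_Suc)
  have "distinct (map (\<lambda>j. Q ! (n - j)) [0..<Suc (n - g)])"
    using q(1,2) n g by (auto simp: distinct_map inj_on_def nth_eq_iff_index_eq simp del: upt_Suc)
  moreover have "set (take h R) \<inter> set (map (\<lambda>j. Q ! (n - j)) [0..<Suc (n - g)]) = {}"
  proof (rule ccontr)
    assume "set (take h R) \<inter> set (map (\<lambda>j. Q ! (n - j)) [0..<Suc (n - g)]) \<noteq> {}"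
    then obtain i j where "i < h" "i < length R" "j < Suc (n - g)" "R ! i = Q ! (n - j)"
      by (auto simp: in_set_conv_nth simp del: upt_Suc)
    then show False using dis[of i "n - j"] g by auto
  qed
  ultimately have dist: "distinct S" using r by (simp add: S_def del: upt_Suc)
  have sub: "set S \<subseteq> V"
    using r(3) q(1,3) n set_take_subset[of h R] by (auto simp: S_def simp del: upt_Suc)
  have "{S ! i, S ! Suc i} \<in> E \<and> ({S ! i, S ! Suc i} \<in> M \<longleftrightarrow> odd i)" if i: "i < ?l" for i
  proof (cases "i < h")
    case True
    then show ?thesis using r(5,6)[of i] h by (simp add: nth1)
  next
    case False
    \<comment> \<open>The edge of \<open>Q\<close> crossed backwards at step \<open>i\<close>;
      \<open>i + Suc j = n + h\<close> is odd, so \<open>i\<close> and \<open>j\<close> have equal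
      parity.\<close>
    define j where "j = n - Suc (i - h)"
    have nj: "n - (i - h) = Suc j" using False i g by (auto simp: j_def)
    have "S ! i = Q ! Suc j" "S ! Suc i = Q ! j"
      using False i g nj nth2[of i] nth2[of "Suc i"] by (auto simp: j_def Suc_diff_le)
    moreover have "j < k" using i False n g by (auto simp: j_def)
    moreover have "odd i = odd j"
    proof -
      have "i + Suc j = n + h" using nj False i g by auto
      then show ?thesis using par by presburger
    qed
    ultimately show ?thesis using q(5,6)[of j] by (auto simp: insert_commute)
  qed
  then have "apath ?l S" using len dist sub r(4) nth1[of 0] by (auto simp: apath_def)
  moreover have "S ! ?l = Q ! g" using nth2[of ?l] g by auto
  ultimately show ?thesis by blast
qed

text \<open>Take the first position \<open>h\<close> of \<open>R\<close> on the segment of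
  \<open>Q\<close> from \<open>g\<close> on. With equal parities the splice reaches
  \<open>Q ! k\<close> in \<open>h + k - n\<close> steps, and minimality of \<open>Q\<close> gives
  \<open>n <= h\<close>; otherwise the walk back reaches \<open>Q ! g\<close> with parity
  \<open>odd g\<close>. The path \<open>R\<close> itself may be any alternating path.\<close>

lemma first_hit:
  assumes Q: "minpath k Q" and R: "apath l R" and g: "g \<le> k"
    and hit: "i0 \<le> l" "g \<le> j0" "j0 \<le> k" "R ! i0 = Q ! j0"
  obtains h n where "h \<le> i0" "g \<le> n" "n \<le> k" "R ! h = Q ! n"
    "(even h = even n \<and> n \<le> h) \<or> (even h \<noteq> even n \<and> level (odd g) (Q ! g) + enat g \<le> enat (h + n))"
proof -
  let ?P = "\<lambda>i. \<exists>j. g \<le> j \<and> j \<le> k \<and> R ! i = Q ! j"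
  define h where "h = (LEAST i. ?P i)"
  have P0: "?P i0" using hit by blast
  have Ph: "?P h" unfolding h_def by (rule LeastI[of ?P, OF P0])
  have hi: "h \<le> i0" unfolding h_def by (rule Least_le[of ?P, OF P0])
  have dis: "R ! i \<noteq> Q ! j" if "i < h" "g \<le> j" "j \<le> k" for i j
    using not_less_Least[of i ?P] that unfolding h_def by blast
  obtain n where n: "g \<le> n" "n \<le> k" "R ! h = Q ! n" using Ph by blast
  have hl: "h \<le> l" using hi hit by simp
  note aQ = minpathD(1)[OF Q]
  show thesis
  proof (cases "even h = even n")
    case True
    let ?S = "take h R @ drop n Q"
    have S: "apath (h + k - n) ?S"
      by (rule apath_join[OF R aQ hl n(2,3) True]) (use dis n in auto)
    have "?S ! (h + k - n) = Q ! k"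
      using apathD(1)[OF R] apathD(1)[OF aQ] hl n by (auto simp: nth_append)
    then have "k \<le> h + k - n"
      using minpath_le[OF Q S] True n by (auto simp: even_diff_nat)
    then show ?thesis using that hi n True by auto
  next
    case False
    obtain S where S: "apath (h + n - g) S" "S ! (h + n - g) = Q ! g"
      using apath_join_rev[OF R aQ hl n(2,3) False n(1)] dis n by (meson le_trans)
    have "even (h + n - g) = odd g" using False n by auto
    then have "level (odd g) (Q ! g) \<le> enat (h + n - g)" using level_le[OF S(1)] S(2) by simp
    then have "level (odd g) (Q ! g) + enat g \<le> enat (h + n - g) + enat g" by (rule add_right_mono)
    then have "level (odd g) (Q ! g) + enat g \<le> enat (h + n)" using n by simp
    then show ?thesis using that hi n False by auto
  qed
qed

text \<open>Turns the walk-back alternative of \<open>first_hit\<close> into a tenacity bound, as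
  the level of parity \<open>g\<close> is at most \<open>g\<close>.\<close>

lemma ten_le_opposite:
  assumes "apath k Q" "g \<le> k" "level (odd g) (Q ! g) + enat g \<le> enat c"
  shows "ten (Q ! g) \<le> enat c"
proof -
  have "ten (Q ! g) \<le> enat g + level (odd g) (Q ! g)"
    using level_nth_le[OF assms(1,2)] by (simp add: ten_eq[of _ g] add_right_mono)
  then show ?thesis using assms(3) by (simp add: add.commute)
qed

lemma level_neqD:
  assumes "apath k P" "m \<le> k" "level (even m) (P ! m) \<noteq> enat m"
  obtains l r where "l < m" "minpath l r" "r ! l = P ! m" "even l = even m"
    "level (even m) (P ! m) = enat l"
proof -
  have "level (even m) (P ! m) < enat m" using level_nth_le[OF assms(1,2)] assms(3) by simp
  then obtain l where l: "level (even m) (P ! m) = enat l" "l < m"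
    by (metis enat_iless enat_ord_simps(2))
  then show thesis using level_obtain[OF l(1)] that by metis
qed

section \<open>Levels and tenacity along a shortest path\<close>

text \<open>A path of length \<open>b\<close> hits the segment from \<open>n > b\<close> on before
  its own position \<open>n\<close>, which leaves only the walk back.\<close>

lemma opposite_level_le:
  assumes P: "minpath k P" and b: "level (odd k) (P ! k) = enat b" and n: "b < n" "n \<le> k"
  shows "level (odd n) (P ! n) + enat n \<le> enat (k + b)"
proof -
  obtain q where q: "minpath b q" "q ! b = P ! k" using level_obtain[OF b] by metis
  obtain h m where "h \<le> b" "n \<le> m" "m \<le> k"
    "(even h = even m \<and> m \<le> h) \<or> (even h \<noteq> even m \<and> level (odd n) (P ! n) + enat n \<le> enat (h + m))"
    using first_hit[OF P minpathD(1)[OF q(1)] n(2), of b k] q n by (metis order_refl)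
  moreover from this n have "\<not> m \<le> h" by auto
  ultimately have "level (odd n) (P ! n) + enat n \<le> enat (h + m)" "h + m \<le> k + b" by auto
  then show ?thesis by (meson enat_ord_simps(1) order_trans)
qed

text \<open>A strictly shorter path of the same parity to \<open>P ! m\<close> hits the segment at
  \<open>h < m <= n\<close>, so it must walk back, with
  \<open>h + n < m + k <= k + b\<close>.\<close>

lemma opposite_level_less:
  assumes P: "minpath k P" and m: "m \<le> k" "m \<le> b" and ne: "level (even m) (P ! m) \<noteq> enat m"
  shows "level (odd m) (P ! m) + enat m < enat (k + b)"
proof -
  obtain l r where r: "l < m" "minpath l r" "r ! l = P ! m"
    using level_neqD[OF minpathD(1)[OF P] m(1) ne] by metis
  obtain h n where "h \<le> l" "m \<le> n" "n \<le> k"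
    "(even h = even n \<and> n \<le> h) \<or> (even h \<noteq> even n \<and> level (odd m) (P ! m) + enat m \<le> enat (h + n))"
    using first_hit[OF P minpathD(1)[OF r(2)] m(1), of l m] r m by (metis order_refl)
  moreover from this r have "\<not> n \<le> h" by auto
  ultimately have "level (odd m) (P ! m) + enat m \<le> enat (h + n)" "h + n < k + b" using r m by auto
  then show ?thesis by (meson enat_ord_simps(2) le_less_trans)
qed

text \<open>If \<open>P\<close> missed the level at \<open>m\<close>, that level would be below
  \<open>m\<close> while the opposite one is at most \<open>k + b - m\<close>, and the tenacity
  would fall below \<open>k + b\<close>.\<close>

lemma honest:
  assumes P: "minpath k P" and b: "level (odd k) (P ! k) = enat b"
    and m: "m \<le> k" and ten: "enat (k + b) \<le> ten (P ! m)"
  shows "level (even m) (P ! m) = enat m"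
proof (rule ccontr)
  assume ne: "level (even m) (P ! m) \<noteq> enat m"
  then obtain l r where l: "l < m" "level (even m) (P ! m) = enat l"
    using level_neqD[OF minpathD(1)[OF P] m] by metis
  have "level (odd m) (P ! m) + enat m \<le> enat (k + b)"
    using opposite_level_le[OF P b _ m] opposite_level_less[OF P m _ ne, of b]
    by (meson less_imp_le not_le)
  then show False using ten l by (cases "level (odd m) (P ! m)") (auto simp: ten_eq[of _ m])
qed

text \<open>With \<open>honest\<close>, position \<open>m <= b\<close> is even the minlevel. An
  opposite path shorter than \<open>m\<close> would have to walk back and give tenacity below
  \<open>m + k <= k + b\<close>.\<close>

lemma honest_up:
  assumes P: "minpath k P" and b: "level (odd k) (P ! k) = enat b"
    and m: "m \<le> k" "m \<le> b" and ten: "enat (k + b) \<le> ten (P ! m)"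
  shows "enat m \<le> level (odd m) (P ! m)"
proof (rule ccontr)
  assume "\<not> ?thesis"
  then obtain l where l: "level (odd m) (P ! m) = enat l" "l < m"
    by (metis enat_iless enat_ord_simps(2) not_le)
  obtain r where r: "minpath l r" "r ! l = P ! m" using level_obtain[OF l(1)] by metis
  obtain h n where hn: "h \<le> l" "m \<le> n" "n \<le> k"
    "(even h = even n \<and> n \<le> h) \<or> (even h \<noteq> even n \<and> level (odd m) (P ! m) + enat m \<le> enat (h + n))"
    using first_hit[OF P minpathD(1)[OF r(1)] m(1), of l m] r m by (metis order_refl)
  moreover from this l have "\<not> n \<le> h" by auto
  ultimately have "ten (P ! m) \<le> enat (h + n)"
    using ten_le_opposite[OF minpathD(1)[OF P] m(1)] by blast
  then have "enat (k + b) \<le> enat (h + n)" using ten by (rule order_trans[rotated])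
  then show False using hn l m by auto
qed

lemma low_opposite_less:
  assumes P: "minpath k P" and m: "m \<le> k" "m \<le> b" and ten: "ten (P ! m) < enat (k + b)"
  shows "level (odd m) (P ! m) + enat m < enat (k + b)"
proof (cases "level (even m) (P ! m) = enat m")
  case True
  then show ?thesis using ten by (simp add: ten_eq[of _ m] add.commute)
qed (rule opposite_level_less[OF P m])

text \<open>The shorter path to \<open>Q ! a\<close> first hits at \<open>h < a\<close>, so it walks
  back, and \<open>h + n < a + b\<close> bounds the left side of \<open>t\<close>.\<close>

lemma crossing_lower:
  assumes Q: "minpath b Q" and a: "a \<le> b" and ne: "level (even a) (Q ! a) \<noteq> enat a"
    and t: "enat t \<le> level (odd a) (Q ! a) + enat a"
  shows "t < a + b"
proof -
  obtain l r where r: "l < a" "minpath l r" "r ! l = Q ! a"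
    using level_neqD[OF minpathD(1)[OF Q] a ne] by metis
  obtain h n where "h \<le> l" "a \<le> n" "n \<le> b"
    "(even h = even n \<and> n \<le> h) \<or> (even h \<noteq> even n \<and> level (odd a) (Q ! a) + enat a \<le> enat (h + n))"
    using first_hit[OF Q minpathD(1)[OF r(2)] a, of l a] r a by (metis order_refl)
  moreover from this r have "\<not> n \<le> h" by auto
  ultimately have "level (odd a) (Q ! a) + enat a \<le> enat (h + n)" "h + n < a + b" using r by auto
  moreover from this t have "enat t \<le> enat (h + n)" by (meson order_trans)
  ultimately show ?thesis by simp
qed

text \<open>Let \<open>l\<close> be the opposite level of \<open>Q ! b\<close>. Walking back would
  cost at most \<open>l + b < t\<close>, so the first hit has equal parities and
  \<open>a <= n <= h <= l\<close>.\<close>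

lemma crossing_upper:
  assumes Q: "minpath b Q" and a: "a \<le> b" and lt: "level (odd b) (Q ! b) + enat b < enat t"
    and t: "enat t \<le> level (odd a) (Q ! a) + enat a"
  shows "a + b < t"
proof -
  obtain l where l: "level (odd b) (Q ! b) = enat l" "l + b < t"
    using lt by (cases "level (odd b) (Q ! b)") auto
  obtain r where r: "minpath l r" "r ! l = Q ! b" using level_obtain[OF l(1)] by metis
  obtain h n where hn: "h \<le> l" "a \<le> n" "n \<le> b"
    "(even h = even n \<and> n \<le> h) \<or> (even h \<noteq> even n \<and> level (odd a) (Q ! a) + enat a \<le> enat (h + n))"
    using first_hit[OF Q minpathD(1)[OF r(1)] a, of l b] r a by (metis order_refl)
  have "\<not> enat t \<le> enat (h + n)" using hn l by auto
  then have "n \<le> h" using hn(4) t order_trans by blast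
  then show ?thesis using hn l by auto
qed

section \<open>Edges of tenacity at least \<open>k + b\<close>\<close>

text \<open>Covers matched and unmatched edges alike, because edge \<open>i\<close> is matched iff
  \<open>i\<close> is odd. The second summand is written as an opposite level so that the bounds on
  those apply.\<close>

definition edge_ten :: "nat \<Rightarrow> 'a list \<Rightarrow> enat" where
  "edge_ten i P = level (even i) (P ! i) + level (odd (Suc i)) (P ! Suc i) + 1"

lemma edge_tenacity_nth:
  assumes "apath k P" "i < k"
  shows "edge_tenacity V E M {P ! i, P ! Suc i} = edge_ten i P"
  using edge_neq[OF apathD(5)[OF assms]] apathD(6)[OF assms]
  by (cases "even i") (simp_all add: edge_tenacity_def edge_ten_def level_def)

text \<open>The summands are at most \<open>i\<close> and \<open>k + b - Suc i\<close>, so reaching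
  \<open>k + b\<close> forces equality in both. The hypothesis \<open>low\<close> excludes
  \<open>Suc i <= b\<close>, where the second bound would be strict.\<close>

lemma heavy_edge:
  assumes P: "minpath k P" and b: "level (odd k) (P ! k) = enat b" and i: "i < k"
    and heavy: "enat (k + b) \<le> edge_ten i P" and low: "b < Suc i \<or> ten (P ! Suc i) < enat (k + b)"
  shows "b < Suc i" "level (even i) (P ! i) = enat i"
    "level (odd (Suc i)) (P ! Suc i) + enat (Suc i) = enat (k + b)"
proof -
  have Li: "level (even i) (P ! i) \<le> enat i" using level_nth_le[OF minpathD(1)[OF P]] i by auto
  then obtain l where l: "level (even i) (P ! i) = enat l" "l \<le> i"
    by (metis enat_ile enat_ord_simps(1))
  show b1: "b < Suc i"
  proof (rule ccontr)
    assume "\<not> b < Suc i"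
    then have "level (odd (Suc i)) (P ! Suc i) + enat (Suc i) < enat (k + b)"
      using low_opposite_less[OF P, of "Suc i" b] low i by auto
    then show False using heavy l
      by (cases "level (odd (Suc i)) (P ! Suc i)") (auto simp: edge_ten_def one_enat_def)
  qed
  have "level (odd (Suc i)) (P ! Suc i) + enat (Suc i) \<le> enat (k + b)"
    using opposite_level_le[OF P b b1] i by auto
  then show "level (even i) (P ! i) = enat i"
    "level (odd (Suc i)) (P ! Suc i) + enat (Suc i) = enat (k + b)"
    using heavy l by (cases "level (odd (Suc i)) (P ! Suc i)"; auto simp: edge_ten_def one_enat_def)+
qed

text \<open>The two crossing lemmas on the prefix ending at \<open>j\<close> give contradictory
  bounds on \<open>Suc i + j\<close>. Low tenacity of the inner endpoints stands in for the edges
  being bridges.\<close>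

lemma heavy_edge_unique:
  assumes P: "minpath k P" and b: "level (odd k) (P ! k) = enat b" and ij: "i < j" "j < k"
    and heavy: "enat (k + b) \<le> edge_ten i P" "enat (k + b) \<le> edge_ten j P"
    and low: "ten (P ! Suc i) < enat (k + b)" "ten (P ! j) < enat (k + b)"
  shows False
proof -
  note hi = heavy_edge[OF P b _ heavy(1)]
  have b1: "b < Suc i" using hi(1) ij low by simp
  have lj: "level (even j) (P ! j) = enat j" using heavy_edge(2)[OF P b _ heavy(2)] ij b1 by auto
  have D: "level (odd (Suc i)) (P ! Suc i) + enat (Suc i) = enat (k + b)" using hi(3) ij low by simp
  let ?Q = "take (Suc j) P"
  have Q: "minpath j ?Q" using minpath_take[OF minpathD(1)[OF P] _ lj] ij by simp
  have "level (even (Suc i)) (P ! Suc i) \<noteq> enat (Suc i)"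
  proof
    assume "level (even (Suc i)) (P ! Suc i) = enat (Suc i)"
    then have "ten (P ! Suc i) = enat (k + b)" using D by (simp add: ten_eq[of _ "Suc i"] add.commute)
    then show False using low by simp
  qed
  then have "k + b < Suc i + j" using crossing_lower[OF Q, of "Suc i"] ij D by simp
  moreover have "level (odd j) (P ! j) + enat j < enat (k + b)"
    using low(2) lj by (simp add: ten_eq[of _ j] add.commute)
  then have "Suc i + j < k + b" using crossing_upper[OF Q, of "Suc i"] ij D by simp
  ultimately show False by simp
qed

section \<open>Minlevel paths and props\<close>

lemma minlevel_eq: "minlevel V E M v = min (level c v) (level (\<not> c) v)"
  by (cases c) (simp_all add: minlevel_def level_def min.commute)

lemma minlevel_le: "minlevel V E M v \<le> level c v"
  unfolding minlevel_eq[of _ c] by (rule min.cobounded1)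

lemma minlevel_path_iff:
  "minlevel_path V E M v p \<longleftrightarrow> (\<exists>k. apath k p \<and> p ! k = v \<and> minlevel V E M v = enat k)"
proof
  assume "minlevel_path V E M v p"
  then have "alternating_path_to V E M v p" "enat (path_length p) = minlevel V E M v"
    by (auto simp: minlevel_path_def evenlevel_path_def oddlevel_path_def)
  then show "\<exists>k. apath k p \<and> p ! k = v \<and> minlevel V E M v = enat k"
    using alternating_path_to_iff[of v p "path_length p"] by auto
next
  assume "\<exists>k. apath k p \<and> p ! k = v \<and> minlevel V E M v = enat k"
  then obtain k where k: "apath k p" "p ! k = v" "minlevel V E M v = enat k" by blast
  then have a: "alternating_path_to V E M v p" "path_length p = k"
    using alternating_path_to_iff by auto
  have "level (even k) v = enat k"
    using level_le[OF k(1)] minlevel_le[of v "even k"] k by simp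
  then show "minlevel_path V E M v p"
    using a k by (auto simp: minlevel_path_def evenlevel_path_def oddlevel_path_def level_def
        split: if_splits)
qed

lemma maxlevel_pathD:
  assumes "maxlevel_path V E M v p"
  obtains k where "minpath k p" "p ! k = v" "maxlevel V E M v = enat k"
proof -
  have a: "alternating_path_to V E M v p" "enat (path_length p) = maxlevel V E M v"
    and l: "level (even (path_length p)) v = enat (path_length p)"
    using assms by (auto simp: maxlevel_path_def evenlevel_path_def oddlevel_path_def level_def)
  then have p: "apath (path_length p) p" "p ! path_length p = v"
    using alternating_path_to_iff[of v p "path_length p"] by simp_all
  show thesis by (rule that[of "path_length p"]) (use p a l in \<open>simp_all add: minpath_def\<close>)
qed

lemma path_edges_neq_Nil: "apath k p \<Longrightarrow> path_edges p \<noteq> [] \<longleftrightarrow> k \<noteq> 0"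
  using length_path_edges[of p] by (cases "path_edges p") (auto simp: apath_def)

lemma last_path_edges:
  assumes "apath (Suc i) p"
  shows "last (path_edges p) = {p ! i, p ! Suc i}"
proof -
  have "path_edges p \<noteq> []" using path_edges_neq_Nil[OF assms] by simp
  then have "last (path_edges p) = path_edges p ! i"
    using apathD(1)[OF assms] by (simp add: last_conv_nth length_path_edges)
  then show ?thesis using apathD(1)[OF assms] by (simp add: nth_path_edges)
qed

lemma prop_edge_prefix:
  assumes "apath k P" "i < k" "minlevel V E M (P ! Suc i) = enat (Suc i)"
  shows "prop_edge V E M {P ! i, P ! Suc i}"
proof -
  let ?q = "take (Suc (Suc i)) P"
  have q: "apath (Suc i) ?q" using apath_take[OF assms(1), of "Suc i"] assms by simp
  then have "minlevel_path V E M (P ! Suc i) ?q" using assms by (auto simp: minlevel_path_iff)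
  moreover have "last (path_edges ?q) = {P ! i, P ! Suc i}" using last_path_edges[OF q] by simp
  moreover have "path_edges ?q \<noteq> []" using path_edges_neq_Nil[OF q] by simp
  ultimately show ?thesis using apathD(5)[OF assms(1,2)] by (auto simp: prop_edge_def)
qed

lemma minlevel_nth_le: "apath k P \<Longrightarrow> n \<le> k \<Longrightarrow> minlevel V E M (P ! n) \<le> enat n"
  by (rule order_trans[OF minlevel_le level_nth_le])

text \<open>If \<open>w\<close> were already on the path, its position there would be at most
  \<open>l\<close> and at least its minlevel.\<close>

lemma apath_extend:
  assumes a: "apath l r" and e: "{r ! l, w} \<in> E" "{r ! l, w} \<in> M \<longleftrightarrow> odd l"
    and lt: "enat l < minlevel V E M w"
  shows "apath (Suc l) (r @ [w])"
proof (rule apath_snoc[OF a e])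
  show "w \<notin> set r"
  proof
    assume "w \<in> set r"
    then obtain n where n: "n < Suc l" "r ! n = w" by (metis apathD(1)[OF a] in_set_conv_nth)
    then have "minlevel V E M w \<le> enat n" using minlevel_nth_le[OF a, of n] by simp
    then have "enat l < enat n" using lt by (rule order.strict_trans2[rotated])
    then show False using n by simp
  qed
qed

lemma prop_edgeI:
  assumes e: "{u, w} \<in> E" and c: "{u, w} \<in> M \<longleftrightarrow> \<not> c"
    and l: "level c u = enat l" "minlevel V E M w = enat (Suc l)"
  shows "prop_edge V E M {u, w}"
proof -
  obtain r where r: "minpath l r" "r ! l = u" "even l = c" using level_obtain[OF l(1)] by blast
  note a = minpathD(1)[OF r(1)]
  have "apath (Suc l) (r @ [w])" using apath_extend[OF a, of w] e c r l by auto
  then show ?thesis using prop_edge_prefix[of "Suc l" "r @ [w]" l] l r apathD(1)[OF a]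
    by (auto simp: nth_append)
qed

text \<open>If the predecessor \<open>u\<close> had a shorter path of the required parity,
  \<open>apath_extend\<close> would carry it to \<open>w\<close> and undercut the minlevel.\<close>

lemma minlevel_last_edge:
  assumes q: "minlevel_path V E M w q" "path_edges q \<noteq> []" "last (path_edges q) = {u, w}"
    and c: "{u, w} \<in> M \<longleftrightarrow> \<not> c"
  shows "level c u + 1 = minlevel V E M w"
proof -
  obtain k where k: "apath k q" "q ! k = w" "minlevel V E M w = enat k"
    using q(1) by (auto simp: minlevel_path_iff)
  obtain i where i: "k = Suc i"
    using q(2) path_edges_neq_Nil[OF k(1)] by (cases k) auto
  have e: "{q ! i, q ! Suc i} = {u, w}" using last_path_edges k i q by metis
  moreover have "q ! i \<noteq> w" using apath_inj[OF k(1), of i k] k i by auto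
  ultimately have u: "q ! i = u" using k i by (auto simp: doubleton_eq_iff)
  have uw: "{u, w} \<in> E" using apathD(5)[OF k(1), of i] i e by simp
  have ci: "c = even i" using apathD(6)[OF k(1), of i] i e c by simp
  have le: "level c u \<le> enat i" using level_nth_le[OF k(1), of i] i u ci by auto
  have "level c u = enat i"
  proof (rule ccontr)
    assume "level c u \<noteq> enat i"
    then obtain l where l: "level c u = enat l" "l < i"
      using le by (metis enat_ile enat_ord_simps(1) le_neq_implies_less)
    obtain r where r: "minpath l r" "r ! l = u" "even l = c" using level_obtain[OF l(1)] by blast
    note a = minpathD(1)[OF r(1)]
    have "enat l < minlevel V E M w" using l k i by simp
    then have s: "apath (Suc l) (r @ [w])" using apath_extend[OF a, of w] uw c r by auto
    show False using minlevel_nth_le[OF s, of "Suc l"] k i l apathD(1)[OF a] by (auto simp: nth_append)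
  qed
  then show ?thesis using k i by (simp add: one_enat_def)
qed

text \<open>Reduces being a prop to an equation between levels, so refuting both equations certifies
  a bridge.\<close>

lemma prop_edge_cases:
  assumes "prop_edge V E M {u, w}" and c: "{u, w} \<in> M \<longleftrightarrow> \<not> c"
  shows "level c u + 1 = minlevel V E M w \<or> level c w + 1 = minlevel V E M u"
proof -
  obtain x q where q: "x \<in> {u, w}" "minlevel_path V E M x q" "path_edges q \<noteq> []"
    "last (path_edges q) = {u, w}"
    using assms(1) unfolding prop_edge_def by blast
  show ?thesis
  proof (cases "x = w")
    case True
    then show ?thesis using minlevel_last_edge[of w q u c] q c by blast
  next
    case False
    then have "x = u" using q(1) by auto
    then show ?thesis using minlevel_last_edge[of u q w c] q c by (metis insert_commute)
  qed
qed

lemma level_inj: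
  assumes "level (even k) u = enat k" "level (even l) u = enat l" "even k = even l"
  shows "k = l"
proof -
  have "enat k = level (even l) u" by (simp only: assms(1) flip: assms(3))
  then show ?thesis by (simp only: assms(2) enat.inject)
qed

section \<open>Mates and unmatched vertices\<close>

abbreviation lm :: enat where "lm \<equiv> min_augmenting_length V E M"

text \<open>An odd path to \<open>u\<close> extends over its matched edge: if \<open>w\<close> were
  on it, that edge would be too, placing \<open>u\<close> elsewhere than at the end. Conversely, an
  even path to the matched vertex \<open>w\<close> must end with this edge.\<close>

lemma mate_level:
  assumes e: "{u, w} \<in> M"
  shows "level True w = level False u + 1"
proof (rule antisym)
  have eE: "{u, w} \<in> E" using e matching by (auto simp: matching_def)
  show "level True w \<le> level False u + 1"
  proof (cases "level False u")
    case (enat k)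
    obtain p where p: "minpath k p" "p ! k = u" "odd k" using level_obtain[OF enat] by auto
    note a = minpathD(1)[OF p(1)]
    have "w \<notin> set p"
    proof
      assume "w \<in> set p"
      then obtain i where i: "i < Suc k" "p ! i = w" by (metis apathD(1)[OF a] in_set_conv_nth)
      have ik: "i < k" using i p edge_neq[OF eE] by (cases "i = k") auto
      show False
      proof (cases "odd i")
        case True
        then have "{w, p ! Suc i} \<in> M" using apathD(6)[OF a ik] i by simp
        then have "p ! Suc i = u" using matching_unique[of w u] e by (metis insert_commute)
        then have "Suc i = k" using apath_inj[OF a, of "Suc i" k] ik p by simp
        then show False using True p by auto
      next
        case False
        show False
        proof (cases i)
          case 0
          then show False using apathD(4)[OF a] i e by (auto simp: unmatched_def)
        next
          case (Suc j)
          then have "{p ! j, w} \<in> M" using apathD(6)[OF a, of j] i ik False by simp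
          then have "p ! j = u" using matching_unique[of w u] e by (metis insert_commute)
          then have "j = k" using apath_inj[OF a, of j k] ik Suc p by simp
          then show False using Suc ik by simp
        qed
      qed
    qed
    then have s: "apath (Suc k) (p @ [w])" using apath_snoc[OF a] eE e p by auto
    have "level True w \<le> enat (Suc k)"
      using level_le[OF s] p apathD(1)[OF a] by (simp add: nth_append)
    then show ?thesis by (simp add: enat one_enat_def)
  qed simp
  show "level False u + 1 \<le> level True w"
  proof (cases "level True w")
    case (enat k)
    obtain p where p: "minpath k p" "p ! k = w" "even k" using level_obtain[OF enat] by auto
    note a = minpathD(1)[OF p(1)]
    have "k \<noteq> 0"
    proof
      assume "k = 0"
      then show False using apathD(4)[OF a] p e by (auto simp: unmatched_def)
    qed
    then obtain j where j: "k = Suc j" by (cases k) auto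
    have "{p ! j, w} \<in> M" using apathD(6)[OF a, of j] j p by auto
    then have "p ! j = u" using matching_unique[of w u] e by (metis insert_commute)
    then have "level False u \<le> enat j" using level_nth_le[OF a, of j] j p by auto
    then have "level False u + 1 \<le> enat j + 1" by (rule add_right_mono)
    then show ?thesis using enat j by (simp add: one_enat_def)
  qed simp
qed

lemma ten_mate:
  assumes "{u, w} \<in> M"
  shows "ten u = ten w"
proof -
  have "level True w = level False u + 1" "level True u = level False w + 1"
    using mate_level[of u w] mate_level[of w u] assms by (simp_all add: insert_commute)
  then show ?thesis using ten_eq[of u 0] ten_eq[of w 0] by (simp add: ac_simps)
qed

text \<open>An odd path to an unmatched vertex has distinct ends and hence is augmenting. Therefore
  every shortest path has a base when \<open>s\<close> is at most \<open>lm\<close>.\<close>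

lemma ten_start:
  assumes "apath k P"
  shows "lm \<le> ten (P ! 0)"
proof -
  have "lm \<le> level False (P ! 0)"
  proof (cases "level False (P ! 0)")
    case (enat l)
    obtain p where p: "minpath l p" "p ! l = P ! 0" "odd l" using level_obtain[OF enat] by auto
    note a = minpathD(1)[OF p(1)]
    have ap: "alternating_path_to V E M (P ! 0) p" "path_length p = l"
      using alternating_path_to_iff[of "P ! 0" p l] a p by simp_all
    have "p \<noteq> []" using apathD(1)[OF a] by auto
    then have hd: "hd p = p ! 0" by (simp add: hd_conv_nth)
    have "p ! 0 \<noteq> p ! l" using apath_inj[OF a, of 0 l] p by (cases l) auto
    then have "augmenting_path V E M p"
      using ap hd p apathD(4)[OF assms] apathD(4)[OF a]
      by (simp add: augmenting_path_def alternating_path_to_def)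
    then have "lm \<le> enat (path_length p)" unfolding min_augmenting_length_def by (intro INF_lower) simp
    then show ?thesis using ap enat by simp
  qed simp
  also have "\<dots> \<le> ten (P ! 0)" by (simp add: ten_eq[of _ 0])
  finally show ?thesis .
qed

section \<open>Bases and their coherence\<close>

definition base_at :: "nat \<Rightarrow> nat \<Rightarrow> 'a list \<Rightarrow> nat \<Rightarrow> bool" where
  "base_at s k P m \<longleftrightarrow> minpath k P \<and> m \<le> k \<and> enat s \<le> ten (P ! m) \<and>
     (\<forall>i. m < i \<longrightarrow> i \<le> k \<longrightarrow> ten (P ! i) < enat s)"

text \<open>A relation rather than a function, since uniqueness is only available once
  \<open>bases_coherent s\<close> is known.\<close>

definition is_base :: "nat \<Rightarrow> 'a \<Rightarrow> 'a \<Rightarrow> bool" where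
  "is_base s u x \<longleftrightarrow> (\<exists>k P m. base_at s k P m \<and> P ! k = u \<and> P ! m = x)"

text \<open>This strengthens uniqueness of the base of a vertex to the form that survives the induction on
  \<open>s\<close>: all vertices behind the base of a shortest path share that base.\<close>

definition bases_coherent :: "nat \<Rightarrow> bool" where
  "bases_coherent s \<longleftrightarrow> (\<forall>k P m l Q g i j. base_at s k P m \<longrightarrow> base_at s l Q g \<longrightarrow>
     m \<le> i \<longrightarrow> i \<le> k \<longrightarrow> g \<le> j \<longrightarrow> j \<le> l \<longrightarrow> P ! i = Q ! j \<longrightarrow> P ! m = Q ! g)"

lemma base_atD:
  assumes "base_at s k P m"
  shows "minpath k P" "apath k P" "m \<le> k" "enat s \<le> ten (P ! m)"
    "\<And>i. m < i \<Longrightarrow> i \<le> k \<Longrightarrow> ten (P ! i) < enat s"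
  using assms by (auto simp: base_at_def minpath_def)

lemma bases_coherentD:
  "bases_coherent s \<Longrightarrow> base_at s k P m \<Longrightarrow> base_at s l Q g \<Longrightarrow>
     m \<le> i \<Longrightarrow> i \<le> k \<Longrightarrow> g \<le> j \<Longrightarrow> j \<le> l \<Longrightarrow> P ! i = Q ! j \<Longrightarrow> P ! m = Q ! g"
  unfolding bases_coherent_def by blast

lemma base_at_eq: "base_at s k P m \<Longrightarrow> m \<le> i \<Longrightarrow> i \<le> k \<Longrightarrow> enat s \<le> ten (P ! i) \<Longrightarrow> i = m"
  using base_atD(5)[of s k P m i] by (meson le_neq_implies_less not_le)

lemma base_at_take:
  assumes "base_at s k P m" "m \<le> n" "n \<le> k" "level (even n) (P ! n) = enat n"
  shows "base_at s n (take (Suc n) P) m"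
  using assms minpath_take[OF base_atD(2)[OF assms(1)] assms(3,4)] by (auto simp: base_at_def)

lemma base_exists:
  assumes P: "minpath k P" and s: "enat s \<le> lm"
  obtains m where "base_at s k P m"
proof -
  have "enat s \<le> ten (P ! 0)" using ten_start[OF minpathD(1)[OF P]] s order_trans by blast
  then obtain m where "m \<le> k" "enat s \<le> ten (P ! m)" "\<And>i. m < i \<Longrightarrow> i \<le> k \<Longrightarrow> \<not> enat s \<le> ten (P ! i)"
    using last_index_with[of "\<lambda>i. enat s \<le> ten (P ! i)" 0 k] by auto
  then show thesis using that[of m] P by (auto simp: base_at_def not_le)
qed

text \<open>The given path need not be shortest to \<open>P ! n\<close>, so a fresh shortest path of
  the same parity supplies the base.\<close>

lemma is_base_exists:
  assumes a: "apath k P" "n \<le> k" and s: "enat s \<le> lm"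
  obtains x where "is_base s (P ! n) x"
proof -
  obtain l where l: "level (even n) (P ! n) = enat l"
    using level_nth_le[OF a] by (metis enat_ile)
  obtain q where q: "minpath l q" "q ! l = P ! n" using level_obtain[OF l] by blast
  obtain m where "base_at s l q m" using base_exists[OF q(1) s] .
  then show thesis using that q unfolding is_base_def by blast
qed

lemma is_base_ten: "is_base s u x \<Longrightarrow> enat s \<le> ten x"
  by (auto simp: is_base_def base_at_def)

lemma is_base_self:
  assumes "is_base s u x" "enat s \<le> ten u"
  shows "x = u"
proof -
  obtain k P m where b: "base_at s k P m" "P ! k = u" "P ! m = x"
    using assms by (auto simp: is_base_def)
  then have "k = m" using base_at_eq[OF b(1), of k] base_atD(3)[OF b(1)] assms(2) by simp
  then show ?thesis using b by simp
qed

lemma is_base_unique: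
  assumes "bases_coherent s" "is_base s u x" "is_base s u y"
  shows "x = y"
proof -
  obtain k P m where b: "base_at s k P m" "P ! k = u" "P ! m = x"
    using assms by (auto simp: is_base_def)
  obtain l Q g where c: "base_at s l Q g" "Q ! l = u" "Q ! g = y"
    using assms by (auto simp: is_base_def)
  show ?thesis using bases_coherentD[OF assms(1) b(1) c(1), of k l] b c base_atD(3)[OF b(1)] base_atD(3)[OF c(1)]
    by simp
qed

lemma base_at_is_base:
  assumes co: "bases_coherent s" and s: "enat s \<le> lm" and b: "base_at s k P m" "m \<le> i" "i \<le> k"
  shows "is_base s (P ! i) (P ! m)"
proof -
  obtain x where x: "is_base s (P ! i) x" using is_base_exists[OF base_atD(2)[OF b(1)] b(3) s] .
  then obtain l Q g where c: "base_at s l Q g" "Q ! l = P ! i" "Q ! g = x"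
    by (auto simp: is_base_def)
  have "P ! m = Q ! g"
    using bases_coherentD[OF co b(1) c(1) b(2,3), of l] c base_atD(3)[OF c(1)] by simp
  then show ?thesis using x c by simp
qed

text \<open>The conclusion contradicts its own mirror image, so the bases cannot differ.\<close>

lemma distinct_bases_edge:
  assumes co: "bases_coherent s" and P: "base_at s k P m" and Q: "base_at s l Q g"
    and ne: "P ! m \<noteq> Q ! g" and lt: "k + 1 + l < s" and par: "even k = even l"
    and e: "{P ! k, Q ! l} \<in> E" "{P ! k, Q ! l} \<in> M \<longleftrightarrow> odd k"
  shows "g < m"
\<comment> \<open>If \<open>P\<close> meets the tail of \<open>Q\<close>, coherence puts the first
  meeting before \<open>m\<close>, and low tenacity of a walk back is impossible, so
  \<open>g <= n <= h < m\<close>. If not, crossing the edge and walking back along \<open>Q\<close>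
  makes the tenacity of \<open>Q ! g\<close> less than \<open>s\<close>.\<close>
proof (cases "\<exists>i j. i \<le> k \<and> g \<le> j \<and> j \<le> l \<and> P ! i = Q ! j")
  case True
  then obtain i j where ij: "i \<le> k" "g \<le> j" "j \<le> l" "P ! i = Q ! j" by blast
  obtain h n where hn: "h \<le> i" "g \<le> n" "n \<le> l" "P ! h = Q ! n"
    "(even h = even n \<and> n \<le> h) \<or> (even h \<noteq> even n \<and> level (odd g) (Q ! g) + enat g \<le> enat (h + n))"
    using first_hit[OF base_atD(1)[OF Q] base_atD(2)[OF P] base_atD(3)[OF Q] ij] .
  have hm: "h < m"
    using bases_coherentD[OF co P Q, of h n] hn ij ne by (meson le_trans not_le)
  have "\<not> level (odd g) (Q ! g) + enat g \<le> enat (h + n)"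
  proof
    assume "level (odd g) (Q ! g) + enat g \<le> enat (h + n)"
    then have "ten (Q ! g) \<le> enat (h + n)"
      using ten_le_opposite[OF base_atD(2)[OF Q] base_atD(3)[OF Q]] by blast
    then have "enat s \<le> enat (h + n)" using base_atD(4)[OF Q] order_trans by blast
    then show False using hn ij lt by simp
  qed
  then show ?thesis using hn hm by auto
next
  case False
  note aP = base_atD(2)[OF P] and aQ = base_atD(2)[OF Q] and gl = base_atD(3)[OF Q]
  have "Q ! l \<notin> set P"
  proof
    assume "Q ! l \<in> set P"
    then obtain i where "i < Suc k" "P ! i = Q ! l" by (metis apathD(1)[OF aP] in_set_conv_nth)
    then show False using False gl by (metis less_Suc_eq_le order_refl)
  qed
  then have R: "apath (Suc k) (P @ [Q ! l])" using apath_snoc[OF aP] e by blast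
  have R1: "(P @ [Q ! l]) ! Suc k = Q ! l" using apathD(1)[OF aP] by (simp add: nth_append)
  have R2: "(P @ [Q ! l]) ! i \<noteq> Q ! j" if "i < Suc k" "g \<le> j" "j \<le> l" for i j
    using apathD(1)[OF aP] that False by (auto simp: nth_append less_Suc_eq_le)
  have "even (Suc k) \<noteq> even l" using par by simp
  then obtain S where S: "apath (Suc k + l - g) S" "S ! (Suc k + l - g) = Q ! g"
    using apath_join_rev[OF R aQ order_refl order_refl R1 _ gl R2] by blast
  have "even (Suc k + l - g) = odd g" using gl par by auto
  then have "level (odd g) (Q ! g) \<le> enat (Suc k + l - g)" using level_le[OF S(1)] S(2) by simp
  then have "level (odd g) (Q ! g) + enat g \<le> enat (Suc k + l - g) + enat g" by (rule add_right_mono)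
  then have "level (odd g) (Q ! g) + enat g \<le> enat (Suc k + l)" using gl by simp
  then have "ten (Q ! g) \<le> enat (Suc k + l)" by (rule ten_le_opposite[OF aQ gl])
  then have "enat s \<le> enat (Suc k + l)" using base_atD(4)[OF Q] order_trans by blast
  then show ?thesis using lt by simp
qed

lemma same_base_edge:
  assumes co: "bases_coherent s" and s: "enat s \<le> lm"
    and e: "{u, w} \<in> E" "{u, w} \<in> M \<longleftrightarrow> \<not> c" and lt: "level c u + level c w + 1 < enat s"
    and x: "is_base s u x" and y: "is_base s w y"
  shows "x = y"
proof (rule ccontr)
  assume ne: "x \<noteq> y"
  obtain k where k: "level c u = enat k" using lt by (cases "level c u") auto
  obtain l where l: "level c w = enat l" using lt by (cases "level c w") auto
  have kl: "k + 1 + l < s" using lt k l by (simp add: one_enat_def)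
  obtain P where P: "minpath k P" "P ! k = u" "even k = c" using level_obtain[OF k] by blast
  obtain Q where Q: "minpath l Q" "Q ! l = w" "even l = c" using level_obtain[OF l] by blast
  obtain m where m: "base_at s k P m" using base_exists[OF P(1) s] .
  obtain g where g: "base_at s l Q g" using base_exists[OF Q(1) s] .
  have "is_base s u (P ! m)" "is_base s w (Q ! g)" using m g P Q unfolding is_base_def by blast+
  then have xy: "P ! m = x" "Q ! g = y" using is_base_unique[OF co] x y by blast+
  have "g < m" using distinct_bases_edge[OF co m g] xy ne kl P Q e by auto
  moreover have "m < g"
    using distinct_bases_edge[OF co g m] xy ne kl P Q e by (auto simp: insert_commute)
  ultimately show False by simp
qed

lemma same_base_light:
  assumes co: "bases_coherent s" and s: "enat s \<le> lm" and P: "apath k P" and ac: "a \<le> c" "c \<le> k"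
    and light: "\<And>i. a \<le> i \<Longrightarrow> i < c \<Longrightarrow> edge_ten i P < enat s"
    and x: "is_base s (P ! a) x"
  shows "is_base s (P ! c) x"
  using ac(1) ac(2) light
proof (induction c rule: dec_induct)
  case base
  show ?case by (rule x)
next
  case (step n)
  have IH: "is_base s (P ! n) x" using step by simp
  obtain y where y: "is_base s (P ! Suc n) y" using is_base_exists[OF P step.prems(1) s] .
  have nk: "n < k" using step by simp
  have "level (even n) (P ! n) + level (even n) (P ! Suc n) + 1 < enat s"
    using step.prems(2)[of n] step.hyps(1) by (simp add: edge_ten_def)
  then have "x = y"
    using same_base_edge[OF co s apathD(5)[OF P nk] _ _ IH y, of "even n"] apathD(6)[OF P nk] by simp
  then show ?case using y by simp
qed

lemma is_base_refl:
  assumes "apath k P" "n \<le> k" "enat s \<le> lm" "enat s \<le> ten (P ! n)"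
  shows "is_base s (P ! n) (P ! n)"
  using is_base_exists[OF assms(1-3)] is_base_self assms(4) by metis

section \<open>Bases of vertices inside a shortest path\<close>

text \<open>At most one edge between \<open>a\<close> and \<open>c\<close> is heavy, so light edges
  link \<open>P ! i\<close> to one of the two ends, each of which is its own base.\<close>

lemma base_of_segment:
  assumes co: "bases_coherent s" and s: "enat s \<le> lm" and P: "minpath k P"
    and b: "level (odd k) (P ! k) = enat b" "k + b = s" and i: "a < i" "i < c" "c \<le> k"
    and ac: "enat s \<le> ten (P ! a)" "enat s \<le> ten (P ! c)"
    and low: "\<And>n. a < n \<Longrightarrow> n < c \<Longrightarrow> ten (P ! n) < enat s"
  shows "is_base s (P ! i) (P ! a) \<or> is_base s (P ! i) (P ! c)"
proof -
  note aP = minpathD(1)[OF P]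
  consider "\<forall>n. a \<le> n \<longrightarrow> n < i \<longrightarrow> edge_ten n P < enat s" | "\<forall>n. i \<le> n \<longrightarrow> n < c \<longrightarrow> edge_ten n P < enat s"
    | n1 n2 where "a \<le> n1" "n1 < i" "enat s \<le> edge_ten n1 P" "i \<le> n2" "n2 < c" "enat s \<le> edge_ten n2 P"
    by (meson not_le)
  then show ?thesis
  proof cases
    case 1
    have "is_base s (P ! a) (P ! a)" using is_base_refl[OF aP _ s ac(1)] i by simp
    then show ?thesis using same_base_light[OF co s aP, of a i "P ! a"] 1 i by auto
  next
    case 2
    obtain x where x: "is_base s (P ! i) x" using is_base_exists[OF aP _ s, of i] i by auto
    then have "is_base s (P ! c) x" using same_base_light[OF co s aP, of i c x] 2 i by auto
    then show ?thesis using x is_base_self ac(2) by blast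
  next
    case 3
    then show ?thesis
      using heavy_edge_unique[OF P b(1), of n1 n2] low[of "Suc n1"] low[of n2] i b(2) by auto
  qed
qed

lemma base_on_path_tight:
  assumes co: "bases_coherent s" and s: "enat s \<le> lm" and P: "base_at (Suc s) k P m"
    and ten: "ten (P ! k) = enat s" and i: "m \<le> i" "i \<le> k"
  shows "\<exists>i'. m \<le> i' \<and> i' \<le> k \<and> is_base s (P ! i) (P ! i')"
proof (cases "enat s \<le> ten (P ! i)")
  case True
  then show ?thesis using is_base_refl[OF base_atD(2)[OF P] i(2) s] i by blast
next
  case False
  note mP = base_atD(1)[OF P]
  obtain b where b: "level (odd k) (P ! k) = enat b" "k + b = s"
    using ten minpathD(2)[OF mP] by (cases "level (odd k) (P ! k)") (auto simp: ten_eq[of _ k])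
  have "enat (Suc s) \<le> ten (P ! m)" using base_atD(4)[OF P] .
  then have tm: "enat s \<le> ten (P ! m)" by (rule enat_Suc_le_imp)
  obtain a where a: "m \<le> a" "a \<le> i" "enat s \<le> ten (P ! a)" "\<And>n. a < n \<Longrightarrow> n \<le> i \<Longrightarrow> \<not> enat s \<le> ten (P ! n)"
    using last_index_with[of "\<lambda>n. enat s \<le> ten (P ! n)" m i] tm i by auto
  define c where "c = (LEAST n. i \<le> n \<and> enat s \<le> ten (P ! n))"
  have ck: "i \<le> k \<and> enat s \<le> ten (P ! k)" using i ten by simp
  have c: "i \<le> c \<and> enat s \<le> ten (P ! c)" unfolding c_def by (rule LeastI, rule ck)
  have c2: "c \<le> k" unfolding c_def by (rule Least_le, rule ck)
  have c3: "\<not> enat s \<le> ten (P ! n)" if "i \<le> n" "n < c" for n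
    using not_less_Least[of n "\<lambda>n. i \<le> n \<and> enat s \<le> ten (P ! n)"] that unfolding c_def by blast
  have ai: "a < i" using a False by (cases "a = i") auto
  have ic: "i < c" using c False by (cases "c = i") auto
  have low: "ten (P ! n) < enat s" if "a < n" "n < c" for n
    using a(4) c3 that by (meson nle_le not_le)
  have "is_base s (P ! i) (P ! a) \<or> is_base s (P ! i) (P ! c)"
    using base_of_segment[OF co s mP b ai ic c2 a(3) _ low] c by blast
  moreover have "a \<le> k" "m \<le> c" using a i c by simp_all
  ultimately show ?thesis using a(1) c2 by blast
qed

text \<open>Behind the base \<open>m'\<close> for \<open>s\<close> coherence applies directly.
  Before it, \<open>P ! m'\<close> has tenacity exactly \<open>s\<close>, and \<open>honest\<close>
  makes the prefix up to \<open>m'\<close> shortest, which reduces to the tight case.\<close>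

lemma base_on_path:
  assumes co: "bases_coherent s" and s: "enat (Suc s) \<le> lm" and P: "base_at (Suc s) k P m"
    and ten: "ten (P ! k) \<le> enat s" and i: "m \<le> i" "i \<le> k"
  shows "\<exists>i'. m \<le> i' \<and> i' \<le> k \<and> is_base s (P ! i) (P ! i')"
proof (cases "ten (P ! k) = enat s")
  case True
  then show ?thesis using base_on_path_tight[OF co enat_Suc_le_imp[OF s] P _ i] by blast
next
  case False
  note s' = enat_Suc_le_imp[OF s] and mP = base_atD(1)[OF P]
  obtain b where b: "level (odd k) (P ! k) = enat b" "k + b \<le> s"
    using ten minpathD(2)[OF mP] by (cases "level (odd k) (P ! k)") (auto simp: ten_eq[of _ k])
  obtain m' where m': "base_at s k P m'" using base_exists[OF mP s'] .
  have tm: "enat s \<le> ten (P ! m)" using enat_Suc_le_imp[OF base_atD(4)[OF P]] .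
  have mm: "m \<le> m'"
    using base_atD(5)[OF m', of m] tm base_atD(3)[OF P] by (meson not_le)
  show ?thesis
  proof (cases "m' \<le> i")
    case True
    then show ?thesis using base_at_is_base[OF co s' m' _ i(2)] mm base_atD(3)[OF m'] by blast
  next
    case False
    then have im: "i < m'" by simp
    have t': "enat s \<le> ten (P ! m')" using base_atD(4)[OF m'] .
    moreover have "ten (P ! m') < enat (Suc s)"
      using base_atD(5)[OF P, of m'] im i base_atD(3)[OF m'] by simp
    ultimately have tm': "ten (P ! m') = enat s" by (simp add: less_enat_Suc)
    have "enat (k + b) \<le> ten (P ! m')" using t' b by (simp add: tm')
    then have "level (even m') (P ! m') = enat m'"
      using honest[OF mP b(1) base_atD(3)[OF m']] by blast
    then have P': "base_at (Suc s) m' (take (Suc m') P) m"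
      using base_at_take[OF P mm base_atD(3)[OF m']] by blast
    obtain i' where i': "m \<le> i'" "i' \<le> m'" "is_base s (take (Suc m') P ! i) (take (Suc m') P ! i')"
      using base_on_path_tight[OF co s' P' _ i(1)] im tm' by auto
    moreover have "i' \<le> k" using i' base_atD(3)[OF m'] by simp
    ultimately show ?thesis using im by auto
  qed
qed

section \<open>The induction step for bases\<close>

text \<open>The first meeting of \<open>P\<close> with the tail of \<open>Q\<close> cannot walk back
  for tenacity reasons, and it is not the common end because the parities differ there. Hence it
  lies before \<open>m\<close>; exchanging the paths gives the contradictory inequality.\<close>

lemma distinct_bases_vertex:
  assumes P: "base_at s k P m" and Q: "base_at s l Q g" and eq: "P ! k = Q ! l"
    and par: "even k \<noteq> even l" and lt: "k + l < s"
    and dis: "\<And>i j. m \<le> i \<Longrightarrow> i < k \<Longrightarrow> g \<le> j \<Longrightarrow> j < l \<Longrightarrow> P ! i \<noteq> Q ! j"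
  shows "g < m"
proof -
  note aP = base_atD(2)[OF P] and aQ = base_atD(2)[OF Q] and gl = base_atD(3)[OF Q]
  obtain h n where hn: "h \<le> k" "g \<le> n" "n \<le> l" "P ! h = Q ! n"
    "(even h = even n \<and> n \<le> h) \<or> (even h \<noteq> even n \<and> level (odd g) (Q ! g) + enat g \<le> enat (h + n))"
    using first_hit[OF base_atD(1)[OF Q] aP gl order_refl gl order_refl eq] .
  have "\<not> level (odd g) (Q ! g) + enat g \<le> enat (h + n)"
  proof
    assume "level (odd g) (Q ! g) + enat g \<le> enat (h + n)"
    then have "ten (Q ! g) \<le> enat (h + n)" by (rule ten_le_opposite[OF aQ gl])
    then have "enat s \<le> enat (h + n)" using base_atD(4)[OF Q] order_trans by blast
    then show False using hn lt by simp
  qed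
  then have nh: "even h = even n" "n \<le> h" using hn(5) by auto
  have "h \<noteq> k"
  proof
    assume "h = k"
    then have "n = l" using hn eq apath_inj[OF aQ, of n l] by simp
    then show False using nh par \<open>h = k\<close> by simp
  qed
  moreover have "n \<noteq> l"
  proof
    assume "n = l"
    then have "h = k" using hn eq apath_inj[OF aP, of h k] by simp
    then show False using \<open>h \<noteq> k\<close> by simp
  qed
  ultimately have "h < m" using dis[of h n] hn by (meson le_neq_implies_less not_le)
  then show ?thesis using nh hn by simp
qed

text \<open>Both tails contain the base for \<open>s\<close> of the common vertex. That vertex is
  either the base for \<open>Suc s\<close> on both, or has tenacity \<open>s\<close> and equal
  parities, where \<open>IH\<close> applies.\<close>

lemma common_vertex_same_base:
  assumes co: "bases_coherent s" and s: "enat (Suc s) \<le> lm"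
    and P: "base_at (Suc s) k P m" and Q: "base_at (Suc s) l Q g" and eq: "P ! k = Q ! l"
    and ten: "ten (P ! k) = enat s" and par: "odd k" "even l"
    and IH: "\<And>i j. m \<le> i \<Longrightarrow> i < k \<Longrightarrow> g \<le> j \<Longrightarrow> j < l \<Longrightarrow> P ! i = Q ! j \<Longrightarrow>
      ten (P ! i) = enat s \<Longrightarrow> even i = even j \<Longrightarrow> P ! m = Q ! g"
    and ij: "m \<le> i" "i < k" "g \<le> j" "j < l" "P ! i = Q ! j"
  shows "P ! m = Q ! g"
proof -
  note aP = base_atD(2)[OF P] and aQ = base_atD(2)[OF Q]
    and mP = base_atD(1)[OF P] and mQ = base_atD(1)[OF Q]
  have Lk: "level (even k) (P ! k) = enat k" "level (even l) (P ! k) = enat l"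
    using minpathD(2)[OF mP] minpathD(2)[OF mQ] eq by auto
  then have skl: "s = k + l" using ten par by (simp add: ten_eq[of _ k])
  have bP: "level (odd k) (P ! k) = enat l" and bQ: "level (odd l) (Q ! l) = enat k"
    using Lk par eq by auto
  \<comment> \<open>As \<open>l\<close> is even, the last edge of \<open>Q\<close> is matched and
    its earlier endpoint also has tenacity \<open>s\<close>. Stopping there keeps
    \<open>j3 < l\<close>, so the common base is not the common end.\<close>
  obtain l' where l': "l = Suc l'" using ij by (cases l) auto
  have "{Q ! l', Q ! l} \<in> M" using apathD(6)[OF aQ, of l'] l' par by simp
  then have tl': "ten (Q ! l') = enat s" using ten_mate eq ten by metis
  have "level (even l') (Q ! l') = enat l'"
    using honest[OF mQ bQ, of l'] tl' skl l' by (simp add: add.commute)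
  then have Q': "base_at (Suc s) l' (take (Suc l') Q) g" using base_at_take[OF Q, of l'] ij l' by auto
  obtain i3 where i3: "m \<le> i3" "i3 \<le> k" "is_base s (P ! i) (P ! i3)"
    using base_on_path[OF co s P _ ij(1)] ij ten by auto
  obtain j3 where j3: "g \<le> j3" "j3 \<le> l'" "is_base s (take (Suc l') Q ! j) (take (Suc l') Q ! j3)"
    using base_on_path[OF co s Q' _ ij(3)] ij l' tl' by auto
  then have j3': "is_base s (P ! i) (Q ! j3)" using ij l' by simp
  then have e3: "P ! i3 = Q ! j3" using is_base_unique[OF co i3(3)] by blast
  show ?thesis
  proof (cases "enat (Suc s) \<le> ten (P ! i3)")
    case True
    then have "i3 = m" "j3 = g"
      using base_at_eq[OF P i3(1,2)] base_at_eq[OF Q j3(1)] e3 j3 l' by auto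
    then show ?thesis using e3 by simp
  next
    case False
    then have t3: "ten (P ! i3) = enat s"
      using is_base_ten[OF i3(3)] less_enat_Suc[of "ten (P ! i3)" s] by (simp add: not_le)
    have "i3 \<noteq> k" using apath_inj[OF aQ, of j3 l] e3 eq j3 l' by auto
    then have ik: "i3 < k" using i3 by simp
    have jl: "j3 < l" using j3 l' by simp
    have Li: "level (even i3) (P ! i3) = enat i3" using honest[OF mP bP i3(2)] t3 skl by simp
    have Lj: "level (even j3) (P ! i3) = enat j3"
      using honest[OF mQ bQ, of j3] t3 skl jl e3 by (simp add: add.commute)
    have "even i3 = even j3"
    proof (rule ccontr)
      assume "even i3 \<noteq> even j3"
      then have "odd i3 = even j3" by auto
      then have "ten (P ! i3) = enat (i3 + j3)" using Li Lj by (simp add: ten_eq[of _ i3])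
      then show False using t3 skl ik jl by simp
    qed
    then show ?thesis using IH[OF i3(1) ik j3(1) jl e3 t3] by blast
  qed
qed

lemma base_unique_opposite:
  assumes co: "bases_coherent s" and s: "enat (Suc s) \<le> lm"
    and P: "base_at (Suc s) k P m" and Q: "base_at (Suc s) l Q g" and eq: "P ! k = Q ! l"
    and ten: "ten (P ! k) = enat s" and par: "even k \<noteq> even l"
    and IH: "\<And>n P Q m g. n < k \<Longrightarrow> base_at (Suc s) n P m \<Longrightarrow> base_at (Suc s) n Q g \<Longrightarrow>
      P ! n = Q ! n \<Longrightarrow> ten (P ! n) = enat s \<Longrightarrow> P ! m = Q ! g"
  shows "P ! m = Q ! g"
proof (rule ccontr)
  assume ne: "P ! m \<noteq> Q ! g"
  note mP = base_atD(1)[OF P] and mQ = base_atD(1)[OF Q]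
  have Lk: "level (even k) (P ! k) = enat k" "level (even l) (P ! k) = enat l"
    using minpathD(2)[OF mP] minpathD(2)[OF mQ] eq by auto
  have pk: "odd k = even l" using par by auto
  then have skl: "s = k + l" using ten Lk by (simp add: ten_eq[of _ k])
  have bP: "level (odd k) (P ! k) = enat l" and bQ: "level (odd l) (Q ! l) = enat k"
    using Lk pk eq by auto
  have IH': "P ! m = Q ! g" if "m \<le> i" "i < k" "g \<le> j" "j < l" "P ! i = Q ! j"
      "ten (P ! i) = enat s" "even i = even j" for i j
  proof -
    have Li: "level (even i) (P ! i) = enat i" using honest[OF mP bP, of i] that skl by simp
    have Lj: "level (even j) (Q ! j) = enat j"
      using honest[OF mQ bQ, of j] that skl by (simp add: add.commute)
    \<comment> \<open>Both positions are the level of the same vertex for the same parity, so the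
      two prefixes have equal length \<open>i < k\<close> and fall under \<open>IH\<close>.\<close>
    have "i = j" by (rule level_inj[OF Li _ that(7)]) (simp only: Lj that(5))
    then have "P ! i = Q ! i" "g \<le> i" "i < l" "level (even i) (Q ! i) = enat i"
      using that(3-5) Lj by simp_all
    then have pre: "base_at (Suc s) i (take (Suc i) P) m" "base_at (Suc s) i (take (Suc i) Q) g"
      "take (Suc i) P ! i = take (Suc i) Q ! i"
      using base_at_take[OF P that(1) _ Li] base_at_take[OF Q, of i] that(2) by simp_all
    have "take (Suc i) P ! m = take (Suc i) Q ! g"
      by (rule IH[OF that(2) pre]) (simp add: that(6))
    then show ?thesis using that(1) \<open>g \<le> i\<close> by simp
  qed
  have dis: "P ! i \<noteq> Q ! j" if ij: "m \<le> i" "i < k" "g \<le> j" "j < l" for i j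
  proof
    assume pq: "P ! i = Q ! j"
    show False
    proof (cases "odd k")
      case True
      then have "P ! m = Q ! g"
        using common_vertex_same_base[OF co s P Q eq ten True _ IH' ij pq] pk by simp
      then show False using ne by simp
    next
      case False
      then have pp: "odd l" "even k" using par by auto
      have "Q ! g = P ! m"
      proof (rule common_vertex_same_base[OF co s Q P eq[symmetric] _ pp _ ij(3,4,1,2) pq[symmetric]])
        show "ten (Q ! l) = enat s" using ten eq by simp
        show "Q ! g = P ! m" if "g \<le> i" "i < l" "m \<le> j" "j < k" "Q ! i = P ! j"
          "ten (Q ! i) = enat s" "even i = even j" for i j
          by (rule IH'[OF that(3,4,1,2) that(5)[symmetric], symmetric]) (use that(5-7) in simp_all)
      qed
      then show False using ne by simp
    qed
  qed
  have "g < m" using distinct_bases_vertex[OF P Q eq par _ dis] skl by simp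
  moreover have "m < g"
  proof (rule distinct_bases_vertex[OF Q P eq[symmetric]])
    show "Q ! i \<noteq> P ! j" if "g \<le> i" "i < l" "m \<le> j" "j < k" for i j
      using dis[OF that(3,4,1,2)] by (rule not_sym)
  qed (use par skl in simp_all)
  ultimately show False by simp
qed

text \<open>Two paths of the same parity are both compared with a shortest path of the opposite parity; the
  vertices it shares with them lie at strictly smaller positions.\<close>

lemma base_unique_same:
  assumes co: "bases_coherent s" and s: "enat (Suc s) \<le> lm"
  shows "base_at (Suc s) n P m \<Longrightarrow> base_at (Suc s) n Q g \<Longrightarrow> P ! n = Q ! n \<Longrightarrow>
    ten (P ! n) = enat s \<Longrightarrow> P ! m = Q ! g"
proof (induction n arbitrary: P Q m g rule: less_induct)
  case (less n)
  obtain l where l: "level (odd n) (P ! n) = enat l"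
    using less.prems(4) by (cases "level (odd n) (P ! n)") (auto simp: ten_eq[of _ n])
  obtain R where R: "minpath l R" "R ! l = P ! n" "even l = odd n" using level_obtain[OF l] by blast
  obtain r where r: "base_at (Suc s) l R r" using base_exists[OF R(1) s] .
  have "P ! m = R ! r"
    using base_unique_opposite[OF co s less.prems(1) r _ less.prems(4) _ less.IH] R by simp
  moreover have "Q ! g = R ! r"
    using base_unique_opposite[OF co s less.prems(2) r _ _ _ less.IH] R less.prems by simp
  ultimately show ?case by simp
qed

lemma base_unique:
  assumes co: "bases_coherent s" and s: "enat (Suc s) \<le> lm"
    and P: "base_at (Suc s) k P m" and Q: "base_at (Suc s) l Q g" and eq: "P ! k = Q ! l"
    and ten: "ten (P ! k) = enat s"
  shows "P ! m = Q ! g"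
proof (cases "even k = even l")
  case True
  have "level (even k) (P ! k) = enat k" "level (even l) (P ! k) = enat l"
    using minpathD(2)[OF base_atD(1)[OF P]] minpathD(2)[OF base_atD(1)[OF Q]] by (simp_all only: eq)
  then have "k = l" using True by (rule level_inj)
  then show ?thesis using base_unique_same[OF co s] P Q eq ten by blast
next
  case False
  then show ?thesis
    using base_unique_opposite[OF co s P Q eq ten] base_unique_same[OF co s] by blast
qed

text \<open>The base for \<open>s\<close> of the shared vertex lies on both tails. Either it is
  already the base for \<open>Suc s\<close>, or it has tenacity \<open>s\<close> and the prefixes up
  to it are shortest, so \<open>base_unique\<close> compares them.\<close>

lemma bases_coherent_Suc:
  assumes co: "bases_coherent s" and s: "enat (Suc s) \<le> lm"
  shows "bases_coherent (Suc s)"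
  unfolding bases_coherent_def
proof (intro allI impI)
  fix k P m l Q g i j
  assume P: "base_at (Suc s) k P m" and Q: "base_at (Suc s) l Q g"
    and ij: "m \<le> i" "i \<le> k" "g \<le> j" "j \<le> l" and eq: "P ! i = Q ! j"
  show "P ! m = Q ! g"
  proof (cases "enat (Suc s) \<le> ten (P ! i)")
    case True
    then have "i = m" "j = g"
      using base_at_eq[OF P ij(1,2)] base_at_eq[OF Q ij(3,4)] eq by auto
    then show ?thesis using eq by simp
  next
    case False
    then have "i \<noteq> m" "j \<noteq> g" using base_atD(4)[OF P] base_atD(4)[OF Q] eq by auto
    then have tk: "ten (P ! k) \<le> enat s" "ten (Q ! l) \<le> enat s"
      using base_atD(5)[OF P, of k] base_atD(5)[OF Q, of l] ij by (auto simp: less_enat_Suc)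
    obtain i3 where i3: "m \<le> i3" "i3 \<le> k" "is_base s (P ! i) (P ! i3)"
      using base_on_path[OF co s P tk(1) ij(1,2)] by blast
    obtain j3 where j3: "g \<le> j3" "j3 \<le> l" "is_base s (Q ! j) (Q ! j3)"
      using base_on_path[OF co s Q tk(2) ij(3,4)] by blast
    have e3: "P ! i3 = Q ! j3" using is_base_unique[OF co i3(3)] j3(3) eq by simp
    show ?thesis
    proof (cases "enat (Suc s) \<le> ten (P ! i3)")
      case True
      then have "i3 = m" "j3 = g"
        using base_at_eq[OF P i3(1,2)] base_at_eq[OF Q j3(1,2)] e3 by auto
      then show ?thesis using e3 by simp
    next
      case False
      then have t3: "ten (P ! i3) = enat s"
        using is_base_ten[OF i3(3)] less_enat_Suc[of "ten (P ! i3)" s] by (simp add: not_le)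
      have take3: "base_at (Suc s) n (take (Suc n) R) r"
        if R: "base_at (Suc s) q R r" and n: "r \<le> n" "n \<le> q"
          and tR: "ten (R ! q) \<le> enat s" "ten (R ! n) = enat s"
        for q R r n
      proof -
        have mR: "level (even q) (R ! q) = enat q" using minpathD(2)[OF base_atD(1)[OF R]] .
        obtain b where b: "level (odd q) (R ! q) = enat b" "q + b \<le> s"
          using tR(1) mR by (cases "level (odd q) (R ! q)") (auto simp: ten_eq[of _ q])
        have "level (even n) (R ! n) = enat n" using honest[OF base_atD(1)[OF R] b(1) n(2)] tR(2) b by simp
        then show ?thesis using base_at_take[OF R n] by blast
      qed
      have "base_at (Suc s) i3 (take (Suc i3) P) m" using take3[OF P i3(1,2) tk(1) t3] .
      moreover have "base_at (Suc s) j3 (take (Suc j3) Q) g"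
        using take3[OF Q j3(1,2) tk(2)] t3 e3 by simp
      ultimately have "take (Suc i3) P ! m = take (Suc j3) Q ! g"
        by (rule base_unique[OF co s]) (simp_all add: e3 t3[unfolded e3])
      then show ?thesis using i3 j3 by simp
    qed
  qed
qed

lemma bases_coherent: "enat s \<le> lm \<Longrightarrow> bases_coherent s"
proof (induction s)
  case 0
  show ?case unfolding bases_coherent_def
  proof (intro allI impI)
    fix k P m l Q g i j
    assume *: "base_at 0 k P m" "base_at 0 l Q g" "m \<le> i" "i \<le> k" "g \<le> j" "j \<le> l" "P ! i = Q ! j"
    \<comment> \<open>For \<open>s = 0\<close> every vertex qualifies, so each base is the end of
      its path.\<close>
    then have "i = m" "j = g"
      using base_at_eq[OF *(1), of i] base_at_eq[OF *(2), of j] by (simp_all flip: zero_enat_def)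
    then show "P ! m = Q ! g" using * by simp
  qed
next
  case (Suc s)
  then show ?case using bases_coherent_Suc enat_Suc_le_imp by blast
qed

section \<open>Existence and uniqueness of the bridge\<close>

lemma bridge_exists:
  assumes P: "minpath k P" and b: "level (odd k) (P ! k) = enat b" "b < k" and t: "enat (k + b) \<le> lm"
  obtains i where "i < k" "\<not> prop_edge V E M {P ! i, P ! Suc i}" "edge_ten i P = enat (k + b)"
proof -
  define s where "s = k + b"
  note aP = minpathD(1)[OF P]
  have s: "enat s \<le> lm" using t by (simp add: s_def)
  have b': "level (odd k) (P ! k) = enat b" by (rule b)
  have "even b = odd k" using level_even_odd[OF b(1)] by simp
  then have odd_s: "odd s" by (simp add: s_def)
  have tk: "ten (P ! k) = enat s" using minpathD(2)[OF P] b by (simp add: ten_eq[of _ k] s_def)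
  have t0: "enat s \<le> ten (P ! 0)" using ten_start[OF aP] s order_trans by blast
  obtain a where a: "a \<le> k" "2 * a < s" "enat s \<le> ten (P ! a)"
    and amax: "\<And>i. a < i \<Longrightarrow> i \<le> k \<Longrightarrow> \<not> (2 * i < s \<and> enat s \<le> ten (P ! i))"
    using last_index_with[of "\<lambda>i. 2 * i < s \<and> enat s \<le> ten (P ! i)" 0 k] t0 b by (auto simp: s_def)
  define c where "c = (LEAST n. a < n \<and> enat s \<le> ten (P ! n))"
  have ck: "a < k \<and> enat s \<le> ten (P ! k)" using a tk b by (auto simp: s_def)
  have c: "a < c \<and> enat s \<le> ten (P ! c)" unfolding c_def by (rule LeastI, rule ck)
  have c2: "c \<le> k" unfolding c_def by (rule Least_le, rule ck)
  have low: "ten (P ! n) < enat s" if "a < n" "n < c" for n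
    using not_less_Least[of n "\<lambda>n. a < n \<and> enat s \<le> ten (P ! n)"] that unfolding c_def by (simp add: not_le)
  \<comment> \<open>The two levels have opposite parity, so \<open>s\<close> is odd and no position
    lies exactly at its half.\<close>
  have "2 * c \<noteq> s" using odd_s by auto
  then have c3: "s < 2 * c" using amax[of c] c c2 by auto
  have bc: "b < c" using c3 b by (simp add: s_def)
  have "\<exists>i. a \<le> i \<and> i < c \<and> enat s \<le> edge_ten i P"
  proof (rule ccontr)
    assume "\<not> ?thesis"
    then have light: "\<And>i. a \<le> i \<Longrightarrow> i < c \<Longrightarrow> edge_ten i P < enat s" by (meson not_le)
    have "is_base s (P ! c) (P ! a)"
      by (rule same_base_light[OF bases_coherent[OF s] s aP _ c2 light is_base_refl[OF aP a(1) s a(3)]])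
        (use c in simp_all)
    then have "P ! a = P ! c" using is_base_self c by blast
    then show False using apath_inj[OF aP a(1) c2] c by simp
  qed
  then obtain i where i: "a \<le> i" "i < c" "enat s \<le> edge_ten i P" by blast
  have ik: "i < k" using i c2 by simp
  have "b < Suc i \<or> ten (P ! Suc i) < enat (k + b)"
    using low[of "Suc i"] i bc by (cases "Suc i = c") (auto simp: s_def)
  note h = heavy_edge[OF P b' ik i(3)[unfolded s_def] this]
  \<comment> \<open>\<open>d\<close> is the level from which the edge would be entered backwards. A
    prop would need minlevel \<open>Suc i\<close> at \<open>P ! Suc i\<close> or
    \<open>Suc d\<close> at \<open>P ! i\<close>; both fail, by the half-way inequality at
    \<open>c\<close> or \<open>a\<close> and by low tenacity elsewhere.\<close>
  obtain d where d: "level (even i) (P ! Suc i) = enat d" "d + Suc i = s"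
    using h(3) by (cases "level (odd (Suc i)) (P ! Suc i)") (auto simp: s_def)
  have "edge_ten i P = enat s" using h(2) d by (simp add: edge_ten_def one_enat_def)
  moreover have "\<not> prop_edge V E M {P ! i, P ! Suc i}"
  proof
    assume "prop_edge V E M {P ! i, P ! Suc i}"
    then consider "level (even i) (P ! i) + 1 = minlevel V E M (P ! Suc i)"
      | "level (even i) (P ! Suc i) + 1 = minlevel V E M (P ! i)"
      using prop_edge_cases[of "P ! i" "P ! Suc i" "even i"] apathD(6)[OF aP ik] by auto
    then show False
    proof cases
      case 1
      then have ml: "minlevel V E M (P ! Suc i) = enat (Suc i)" using h(2) by (simp add: one_enat_def)
      show False
      proof (cases "Suc i = c")
        case True
        then show False using minlevel_le[of "P ! Suc i" "even i"] ml d c3 by simp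
      next
        case False
        then have "ten (P ! Suc i) < enat s" using low[of "Suc i"] i by simp
        then show False using minlevel_le[of "P ! Suc i" "odd i"] ml d
          by (cases "level (odd i) (P ! Suc i)") (auto simp: ten_eq[of _ "Suc i"])
      qed
    next
      case 2
      then have ml: "minlevel V E M (P ! i) = enat (Suc d)" using d by (simp add: one_enat_def)
      show False
      proof (cases "i = a")
        case True
        then show False using minlevel_nth_le[OF aP, of i] ik ml d a by simp
      next
        case False
        then have "ten (P ! i) < enat s" using low[of i] i by simp
        then show False using minlevel_le[of "P ! i" "odd i"] ml d h(2)
          by (cases "level (odd i) (P ! i)") (auto simp: ten_eq[of _ i])
      qed
    qed
  qed
  ultimately show thesis using that ik by (simp add: s_def)
qed

text \<open>Follows \<open>heavy_edge_unique\<close>, but the inner endpoints may have tenacity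
  \<open>k + b\<close> or more. In those cases not being a prop supplies the missing strict
  inequality.\<close>

lemma bridge_unique:
  assumes P: "minpath k P" and b: "level (odd k) (P ! k) = enat b" and ij: "i < j" "j < k"
    and bi: "\<not> prop_edge V E M {P ! i, P ! Suc i}" "edge_ten i P = enat (k + b)"
    and bj: "\<not> prop_edge V E M {P ! j, P ! Suc j}" "edge_ten j P = enat (k + b)"
  shows False
proof -
  note aP = minpathD(1)[OF P]
  have ik: "i < k" using ij by simp
  have low: "b < Suc i \<or> ten (P ! Suc i) < enat (k + b)"
  proof (rule ccontr)
    assume "\<not> ?thesis"
    then have n: "Suc i \<le> b" "enat (k + b) \<le> ten (P ! Suc i)" by auto
    have "level (even (Suc i)) (P ! Suc i) = enat (Suc i)"
      "enat (Suc i) \<le> level (odd (Suc i)) (P ! Suc i)"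
      using honest[OF P b _ n(2)] honest_up[OF P b _ n] ik by auto
    then have "minlevel V E M (P ! Suc i) = enat (Suc i)"
      using minlevel_eq[of "P ! Suc i" "even (Suc i)"] by (simp add: min_def)
    then show False using prop_edge_prefix[OF aP ik] bi by blast
  qed
  note hi = heavy_edge[OF P b ik _ low, unfolded bi(2), OF order_refl]
  have bj': "b < Suc j" using hi(1) ij by simp
  note hj = heavy_edge[OF P b ij(2) _ disjI1[OF bj'], unfolded bj(2), OF order_refl]
  define t where "t = k + b"
  have D: "level (odd (Suc i)) (P ! Suc i) + enat (Suc i) = enat t" using hi(3) by (simp add: t_def)
  let ?Q = "take (Suc j) P"
  have Q: "minpath j ?Q" using minpath_take[OF aP _ hj(2)] ij by simp
  have "t < Suc i + j"
  proof (cases "level (even (Suc i)) (P ! Suc i) = enat (Suc i)")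
    case True
    have "\<not> enat (Suc i) \<le> level (odd (Suc i)) (P ! Suc i)"
    proof
      assume "enat (Suc i) \<le> level (odd (Suc i)) (P ! Suc i)"
      then have "minlevel V E M (P ! Suc i) = enat (Suc i)"
        using minlevel_eq[of "P ! Suc i" "even (Suc i)"] True by (simp add: min_def)
      then show False using prop_edge_prefix[OF aP ik] bi by blast
    qed
    then have "t < Suc i + Suc i"
      using D by (cases "level (odd (Suc i)) (P ! Suc i)") auto
    then show ?thesis using ij by simp
  next
    case False
    then show ?thesis using crossing_lower[OF Q, of "Suc i" t] ij D by simp
  qed
  moreover have "Suc i + j < t"
  proof (cases "level (odd j) (P ! j) + enat j < enat t")
    case True
    then show ?thesis using crossing_upper[OF Q, of "Suc i" t] ij D by simp
  next
    case False
    have "level (odd j) (P ! j) + enat j \<le> enat t"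
      using opposite_level_le[OF P b, of j] hi(1) ij by (simp add: t_def)
    then have eq: "level (odd j) (P ! j) + enat j = enat t" using False by simp
    obtain d where d: "level (even j) (P ! Suc j) = enat d" "d + Suc j = t"
      using hj(3) by (cases "level (odd (Suc j)) (P ! Suc j)") (auto simp: t_def)
    have lj: "level (odd j) (P ! j) = enat (Suc d)"
      using eq d by (cases "level (odd j) (P ! j)") auto
    \<comment> \<open>Otherwise edge \<open>j\<close>, entered from \<open>P ! Suc j\<close>, would
      be a prop. Hence \<open>j < Suc d\<close> and \<open>Suc i + j <= 2 * j < t\<close>.\<close>
    have "minlevel V E M (P ! j) \<noteq> enat (Suc d)"
      using prop_edgeI[of "P ! Suc j" "P ! j" "even j" d] bj(1) d apathD(5,6)[OF aP ij(2)]
      by (auto simp: insert_commute)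
    then have "j < Suc d" using minlevel_eq[of "P ! j" "even j"] hj(2) lj by (auto simp: min_def split: if_splits)
    then show ?thesis using d ij by simp
  qed
  ultimately show False by simp
qed

end

theorem theorem6:
  fixes V :: "'a set" and E M :: "'a set set" and v :: 'a and t :: enat and p :: "'a list"
  assumes "finite_graph V E"
    and "matching E M"
    and "unmatched V M \<noteq> {}"
    and "v \<in> V"
    and "vertex_tenacity V E M v = t"
    and "t \<le> min_augmenting_length V E M"
    and "maxlevel_path V E M v p"
  shows "\<exists>!e. e \<in> set (path_edges p) \<and> bridge V E M e \<and> edge_tenacity V E M e = t"
proof -
  interpret matched_graph V E M using assms(1,2) by unfold_locales
  obtain k where p: "minpath k p" and v: "p ! k = v" and mx: "maxlevel V E M v = enat k"
    using maxlevel_pathD[OF assms(7)] .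
  note a = minpathD(1)[OF p]
  have "level (odd k) v \<le> enat k" unfolding mx[symmetric] by (simp add: maxlevel_def level_def)
  then obtain b where b: "level (odd k) v = enat b" "b \<le> k" by (metis enat_ile enat_ord_simps(1))
  \<comment> \<open>A finite level has the parity it is indexed by, so the inequality from the
    maxlevel is strict.\<close>
  have "b \<noteq> k" using level_even_odd[OF b(1)] by auto
  then have bk: "b < k" using b by simp
  have t: "t = enat (k + b)"
    using assms(5) minpathD(2)[OF p] v b by (simp add: ten_eq[of _ k] flip: ten_def)
  have b': "level (odd k) (p ! k) = enat b" using b v by simp
  have tl: "enat (k + b) \<le> lm" using assms(6) t by simp
  \<comment> \<open>Edges of the path are traded for positions, so uniqueness becomes a comparison
    of two indices.\<close>
  have edge: "e \<in> set (path_edges p) \<and> bridge V E M e \<and> edge_tenacity V E M e = t \<longleftrightarrow>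
      (\<exists>i<k. e = {p ! i, p ! Suc i} \<and> \<not> prop_edge V E M e \<and> edge_ten i p = enat (k + b))" for e
    using apathD(1,5)[OF a] edge_tenacity_nth[OF a] t by (auto simp: in_set_path_edges bridge_def)
  obtain i where i: "i < k" "\<not> prop_edge V E M {p ! i, p ! Suc i}" "edge_ten i p = enat (k + b)"
    using bridge_exists[OF p b' bk tl] .
  show ?thesis
  proof (rule ex1I[of _ "{p ! i, p ! Suc i}"])
    show "{p ! i, p ! Suc i} \<in> set (path_edges p) \<and> bridge V E M {p ! i, p ! Suc i} \<and>
      edge_tenacity V E M {p ! i, p ! Suc i} = t"
      unfolding edge using i by blast
  next
    fix e
    assume "e \<in> set (path_edges p) \<and> bridge V E M e \<and> edge_tenacity V E M e = t"
    then obtain j where j: "j < k" "e = {p ! j, p ! Suc j}" "\<not> prop_edge V E M e"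
      "edge_ten j p = enat (k + b)"
      unfolding edge by blast
    note pj = j(3)[unfolded j(2)]
    have "i = j"
    proof (rule ccontr)
      assume "i \<noteq> j"
      then consider "i < j" | "j < i" by linarith
      then show False
      proof cases
        case 1
        show False by (rule bridge_unique[OF p b' 1 j(1) i(2,3) pj j(4)])
      next
        case 2
        show False by (rule bridge_unique[OF p b' 2 i(1) pj j(4) i(2,3)])
      qed
    qed
    then show "e = {p ! i, p ! Suc i}" using j(2) by simp
  qed
qed
end
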